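(* Let $R$ be a commutative Noetherian ring with identity, let $\mathbf{x} = x_1,\ldots,x_d$ be a regular $R$-sequence contained in the Jacobson radical of $R$, and suppose that the ideal $\mathbf{x}R = x_1R+\cdots+x_dR$ is prime. Let $I$ be a non-zero monomial ideal of $R$ with respect to $\mathbf{x}$. Then $I$ has a decomposition as an irredundant finite intersection of primary ideals, each of the form $$x_{\tau(1)}^{e_1}R+\cdots+x_{\tau(s)}^{e_s}R,$$ where $\tau$ is a permutation of $\{1,\ldots,d\}$, $1\le s\le d$, and $e_1,\ldots,e_s$ are positive integers ($\tau$, $s$ and the $e_i$ may vary with the ideal). Moreover, such a decomposition is unique: any two irredundant finite intersections of primary ideals of this form that are equal to $I$ involve the same set of ideals.
   Context: A monomial with respect to $\mathbf{x}$ is an element $x_1^{e_1}\cdots x_d^{e_d}$ with $e_1,\ldots,e_d$ non-negative integers. A monomial ideal with respect to $\mathbf{x}$ is a proper ideal of $R$ generated by monomials with respect to $\mathbf{x}$. A finite intersection of ideals is irredundant if no ideal in it contains the intersection of the others. A regular $R$-sequence satisfies $x_1R+\cdots+x_dR\ne R$, and each $x_i$ is a non-zerodivisor on $R/(x_1R+\cdots+x_{i-1}R)$. *)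

theory Defs
  imports "HOL-Algebra.Algebra" "HOL-Combinatorics.Permutations"
begin

definition jacobson_radical :: "('a, 'b) ring_scheme \<Rightarrow> 'a set" where
  "jacobson_radical R = carrier R \<inter> \<Inter> {M. maximalideal M R}"

locale primaryideal = ideal + cring +
  assumes I_notcarr: "carrier R \<noteq> I"
    and I_primary: "\<lbrakk>a \<in> carrier R; b \<in> carrier R; a \<otimes> b \<in> I\<rbrakk>
      \<Longrightarrow> a \<in> I \<or> (\<exists>n::nat. n > 0 \<and> b [^] n \<in> I)"

(* The elements of the sequence are x 1, ..., x d; other values of x are irrelevant.
   The quotient R/(x 1, ..., x (i - 1)) is R/0 for i = 1. *)
definition regular_sequence :: "('a, 'b) ring_scheme \<Rightarrow> nat \<Rightarrow> (nat \<Rightarrow> 'a) \<Rightarrow> bool" where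
  "regular_sequence R d x \<longleftrightarrow>
     x ` {1..d} \<subseteq> carrier R \<and>
     Idl\<^bsub>R\<^esub> (x ` {1..d}) \<noteq> carrier R \<and>
     (\<forall>i\<in>{1..d}. let J = Idl\<^bsub>R\<^esub> (x ` {1..<i}) in
        \<forall>y\<in>carrier (R Quot J).
          (J +>\<^bsub>R\<^esub> x i) \<otimes>\<^bsub>R Quot J\<^esub> y = \<zero>\<^bsub>R Quot J\<^esub> \<longrightarrow> y = \<zero>\<^bsub>R Quot J\<^esub>)"

definition monomials :: "('a, 'b) ring_scheme \<Rightarrow> nat \<Rightarrow> (nat \<Rightarrow> 'a) \<Rightarrow> 'a set" where
  "monomials R d x =
     {finprod R (\<lambda>i. x i [^]\<^bsub>R\<^esub> e i) {1..d} | e :: nat \<Rightarrow> nat. True}"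

definition monomial_ideal ::
  "('a, 'b) ring_scheme \<Rightarrow> nat \<Rightarrow> (nat \<Rightarrow> 'a) \<Rightarrow> 'a set \<Rightarrow> bool" where
  "monomial_ideal R d x I \<longleftrightarrow>
     ideal I R \<and> I \<noteq> carrier R \<and> (\<exists>S \<subseteq> monomials R d x. I = Idl\<^bsub>R\<^esub> S)"

definition pure_power_ideal ::
  "('a, 'b) ring_scheme \<Rightarrow> nat \<Rightarrow> (nat \<Rightarrow> 'a) \<Rightarrow> 'a set \<Rightarrow> bool" where
  "pure_power_ideal R d x Q \<longleftrightarrow>
     (\<exists>\<tau> s. \<exists>e :: nat \<Rightarrow> nat.
        \<tau> permutes {1..d} \<and> 1 \<le> s \<and> s \<le> d \<and> (\<forall>j\<in>{1..s}. e j > 0) \<and>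
        Q = Idl\<^bsub>R\<^esub> ((\<lambda>j. x (\<tau> j) [^]\<^bsub>R\<^esub> e j) ` {1..s}))"

(* Intersecting with the carrier makes the empty intersection of ideals equal to the whole ring. *)
definition irredundant_intersection ::
  "('a, 'b) ring_scheme \<Rightarrow> 'a set list \<Rightarrow> bool" where
  "irredundant_intersection R Qs \<longleftrightarrow>
     (\<forall>k<length Qs. \<not> carrier R \<inter> (\<Inter>j\<in>{..<length Qs} - {k}. Qs ! j) \<subseteq> Qs ! k)"

definition pure_power_decomposition ::
  "('a, 'b) ring_scheme \<Rightarrow> nat \<Rightarrow> (nat \<Rightarrow> 'a) \<Rightarrow> 'a set \<Rightarrow> 'a set list \<Rightarrow> bool" where
  "pure_power_decomposition R d x I Qs \<longleftrightarrow>
     (\<forall>Q\<in>set Qs. primaryideal Q R \<and> pure_power_ideal R d x Q) \<and>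
     I = carrier R \<inter> \<Inter> (set Qs) \<and>
     irredundant_intersection R Qs"

end

(*
  By Nakayama-type arguments in the Jacobson radical, the sequence may be permuted and
  primality descends from (x_1, ..., x_d) to every P_T = (x_t : t in T), with x_i outside P_T
  for i outside T.  Hence an element outside P_T is a non-zerodivisor modulo each ideal
  generated by monomials in the variables T.  So pure power ideals are primary, and colons of
  monomial ideals by monomials are computed on exponents, as in a polynomial ring.

  Existence: if s = u + v with u and v of disjoint support, then
  (S, x^s) is the intersection of (S, x^u) and (S, x^v), and the total degree of the generators drops.
  Uniqueness: if no ideal Q of a finite family of pure power ideals lies in the pure power
  ideal P, choose from each Q a generator outside P; some common multiple of these still avoids
  P.  So an intersection of pure power ideals lies in P only if one of them does.
*)
theory Submission
  imports Defs
begin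

section \<open>Ideals and regular elements\<close>

text \<open>Elements of \<open>R\<close> have no canonical expansion in monomials, so membership in
  a monomial ideal cannot be read off term by term. Its replacement is cancellation of elements
  outside suitable primes, with the total degree of a finite generating set as induction measure.

  The regularity hypothesis speaks of initial segments only. The Jacobson radical makes it
  independent of the order, through one fact: for y in the radical and J an ideal, a set E contained
  in J + yE lies in J. With E the colon of J by an element z this becomes
  \<open>regular_mod_descend\<close>, the common source of the exchange of two elements and of the
  descent of primality.

  Several components may have the same radical, as in (x^2, y) \<inter> (x, y^2), so uniqueness
  cannot be read off from associated primes. Pure power ideals are instead treated like primes: one
  that contains a finite intersection of pure power ideals contains a member of it.\<close>

lemma (in cring) genideal_induct [consumes 2, case_names zero gen add]:
  assumes r: "r \<in> Idl S" and S: "S \<subseteq> carrier R"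
    and zero: "P \<zero>"
    and gen: "\<And>c s. \<lbrakk>c \<in> carrier R; s \<in> S\<rbrakk> \<Longrightarrow> P (c \<otimes> s)"
    and add: "\<And>u v. \<lbrakk>u \<in> Idl S; v \<in> Idl S; P u; P v\<rbrakk> \<Longrightarrow> P (u \<oplus> v)"
  shows "P r"
proof -
  \<comment> \<open>\<open>P\<close> alone need not be stable under multiplication. Demanding it of
    all multiples makes \<open>?K\<close> an ideal, and the multiple by one gives \<open>P\<close>
    back.\<close>
  let ?K = "{u \<in> Idl S. \<forall>c\<in>carrier R. P (c \<otimes> u)}"
  interpret I: ideal "Idl S" R by (rule genideal_ideal[OF S])
  have "ideal ?K R"
  proof (rule idealI[OF ring_axioms add.subgroupI])
    show "?K \<subseteq> carrier R" using I.a_subset by auto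
    have "\<zero> \<in> ?K" using zero by simp
    then show "?K \<noteq> {}" by blast
  next
    fix a assume a: "a \<in> ?K"
    then have "a \<in> carrier R" using I.a_subset by auto
    then have "c \<otimes> (\<ominus> a) = (\<ominus> c) \<otimes> a" if "c \<in> carrier R" for c
      using that by (simp add: l_minus r_minus)
    then show "\<ominus> a \<in> ?K" using a by auto
  next
    fix a b assume a: "a \<in> ?K" and b: "b \<in> ?K"
    then have "a \<in> carrier R" "b \<in> carrier R" using I.a_subset by auto
    then have "c \<otimes> (a \<oplus> b) = c \<otimes> a \<oplus> c \<otimes> b" if "c \<in> carrier R" for c
      using that by (simp add: r_distr)
    then show "a \<oplus> b \<in> ?K" using a b by (auto intro!: add I.I_l_closed)
  next
    fix a y assume a: "a \<in> ?K" and y: "y \<in> carrier R"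
    then have aR: "a \<in> carrier R" using I.a_subset by auto
    then have "c \<otimes> (y \<otimes> a) = (c \<otimes> y) \<otimes> a" if "c \<in> carrier R" for c
      using that y by (simp add: m_assoc)
    then show *: "y \<otimes> a \<in> ?K" using a y by (auto intro!: I.I_l_closed)
    show "a \<otimes> y \<in> ?K" using * m_comm[OF aR y] by simp
  qed
  moreover have "S \<subseteq> ?K" using gen genideal_self[OF S] by auto
  ultimately have "r \<in> ?K" using genideal_minimal r by blast
  moreover from this have "r \<in> carrier R" using I.a_subset by auto
  ultimately have "P (\<one> \<otimes> r)" by blast
  with \<open>r \<in> carrier R\<close> show ?thesis by simp
qed

lemma (in cring) genideal_insertE:
  assumes "r \<in> Idl (insert a S)" and a: "a \<in> carrier R" and S: "S \<subseteq> carrier R"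
  obtains u c where "u \<in> Idl S" "c \<in> carrier R" "r = u \<oplus> c \<otimes> a"
proof -
  interpret I: ideal "Idl S" R by (rule genideal_ideal[OF S])
  have aS: "insert a S \<subseteq> carrier R" using a S by simp
  from \<open>r \<in> Idl (insert a S)\<close> aS have "\<exists>u\<in>Idl S. \<exists>c\<in>carrier R. r = u \<oplus> c \<otimes> a"
  proof (induct r rule: genideal_induct)
    case zero
    show ?case using a by (intro bexI[of _ \<zero>]) auto
  next
    case (gen c s)
    show ?case
    proof (cases "s = a")
      case True
      then show ?thesis using gen a by (intro bexI[of _ \<zero>] bexI[of _ c]) auto
    next
      case False
      then have "s \<in> S" using gen by simp
      then have "s \<in> Idl S" using genideal_self[OF S] by blast
      then show ?thesis using gen a I.a_subset I.I_l_closed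
        by (intro bexI[of _ "c \<otimes> s"] bexI[of _ \<zero>]) auto
    qed
  next
    case (add u v)
    then obtain p c q e where *: "p \<in> Idl S" "c \<in> carrier R" "u = p \<oplus> c \<otimes> a"
        "q \<in> Idl S" "e \<in> carrier R" "v = q \<oplus> e \<otimes> a" by blast
    then have "u \<oplus> v = (p \<oplus> q) \<oplus> (c \<oplus> e) \<otimes> a"
      using a I.Icarr by (simp add: l_distr a_ac)
    then show ?case using * by blast
  qed
  then show ?thesis using that by blast
qed

lemma (in cring) genideal_insertI:
  assumes "u \<in> Idl S" "c \<in> carrier R" and a: "a \<in> carrier R" and S: "S \<subseteq> carrier R"
  shows "u \<oplus> c \<otimes> a \<in> Idl (insert a S)"
proof -
  have aS: "insert a S \<subseteq> carrier R" using a S by simp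
  interpret I: ideal "Idl (insert a S)" R by (rule genideal_ideal[OF aS])
  have "u \<in> Idl (insert a S)" using assms(1) subset_Idl_subset[OF aS, of S] by blast
  moreover have "a \<in> Idl (insert a S)" using genideal_self[OF aS] by blast
  ultimately show ?thesis using assms(2) I.I_l_closed by simp
qed

lemma (in ideal) mem_add_cancel:
  assumes "a \<oplus> b \<in> I" "a \<in> I" "b \<in> carrier R"
  shows "b \<in> I"
proof -
  have aR: "a \<in> carrier R" using assms(2) Icarr by simp
  have "\<ominus> a \<in> I" using assms(2) by simp
  then have "\<ominus> a \<oplus> (a \<oplus> b) \<in> I"
    using assms(1) by (rule additive_subgroup.a_closed[OF additive_subgroup_axioms])
  then show ?thesis using aR assms(3) by (simp add: r_neg1)
qed

text \<open>Regularity on the quotient, phrased by elements of \<open>R\<close> so that later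
  arguments never handle cosets.\<close>

definition regular_mod :: "('a, 'b) ring_scheme \<Rightarrow> 'a set \<Rightarrow> 'a \<Rightarrow> bool" where
  "regular_mod R J b \<longleftrightarrow> (\<forall>r\<in>carrier R. b \<otimes>\<^bsub>R\<^esub> r \<in> J \<longrightarrow> r \<in> J)"

lemma regular_modD:
  "\<lbrakk>regular_mod R J b; b \<otimes>\<^bsub>R\<^esub> r \<in> J; r \<in> carrier R\<rbrakk> \<Longrightarrow> r \<in> J"
  by (auto simp: regular_mod_def)

lemma (in ideal) regular_mod_if_quotient_regular:
  assumes "cring R" and b: "b \<in> carrier R"
    and reg: "\<forall>y\<in>carrier (R Quot I). (I +> b) \<otimes>\<^bsub>R Quot I\<^esub> y = \<zero>\<^bsub>R Quot I\<^esub> \<longrightarrow> y = \<zero>\<^bsub>R Quot I\<^esub>"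
  shows "regular_mod R I b"
  unfolding regular_mod_def
proof (intro ballI impI)
  fix r assume r: "r \<in> carrier R" and br: "b \<otimes> r \<in> I"
  have "(I +> b) \<otimes>\<^bsub>R Quot I\<^esub> (I +> r) = I +> (b \<otimes> r)"
    using rcoset_mult_add[OF b r] by (simp add: FactRing_def)
  also have "\<dots> = \<zero>\<^bsub>R Quot I\<^esub>"
    using a_rcos_zero[OF ideal_axioms br] by (simp add: FactRing_def)
  finally have "I +> r = \<zero>\<^bsub>R Quot I\<^esub>"
    using reg r by (auto simp: FactRing_def A_RCOSETS_def')
  then show "r \<in> I" using rcos_const_imp_mem[OF r] by (simp add: FactRing_def)
qed

text \<open>Among the subfamilies with the same intersection, one of least cardinality is
  irredundant, since a redundant member could be dropped.\<close>

lemma irredundant_subfamily: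
  assumes "finite \<Q>"
  obtains Qs where "set Qs \<subseteq> \<Q>" "carrier R \<inter> \<Inter>(set Qs) = carrier R \<inter> \<Inter>\<Q>"
    "irredundant_intersection R Qs"
proof -
  let ?P = "\<lambda>\<A>. \<A> \<subseteq> \<Q> \<and> carrier R \<inter> \<Inter>\<A> = carrier R \<inter> \<Inter>\<Q>"
  have "\<exists>\<A>. ?P \<A> \<and> (\<forall>\<B>. ?P \<B> \<longrightarrow> card \<A> \<le> card \<B>)"
    by (rule ex_has_least_nat[of ?P \<Q>]) simp
  then obtain \<A> where A: "?P \<A>" and min: "\<And>\<B>. ?P \<B> \<Longrightarrow> card \<A> \<le> card \<B>" by blast
  have fin: "finite \<A>" using A assms finite_subset by blast
  \<comment> \<open>Irredundancy is stated by positions, so a repeated entry would be redundant; the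
    list must be distinct.\<close>
  then obtain Qs where Qs: "set Qs = \<A>" "distinct Qs" using finite_distinct_list by blast
  have "irredundant_intersection R Qs"
    unfolding irredundant_intersection_def
  proof (intro allI impI notI)
    fix k assume k: "k < length Qs"
      and sub: "carrier R \<inter> (\<Inter>j\<in>{..<length Qs} - {k}. Qs ! j) \<subseteq> Qs ! k"
    have "(\<lambda>j. Qs ! j) ` ({..<length Qs} - {k}) \<subseteq> \<A> - {Qs ! k}"
      using Qs k by (auto simp: nth_eq_iff_index_eq)
    then have "\<Inter>(\<A> - {Qs ! k}) \<subseteq> (\<Inter>j\<in>{..<length Qs} - {k}. Qs ! j)"
      by (rule Inter_anti_mono)
    then have *: "carrier R \<inter> \<Inter>(\<A> - {Qs ! k}) \<subseteq> Qs ! k" using sub by (meson Int_mono order_refl order_trans)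
    have "\<A> \<subseteq> insert (Qs ! k) (\<A> - {Qs ! k})" by blast
    then have "\<Inter>(insert (Qs ! k) (\<A> - {Qs ! k})) \<subseteq> \<Inter>\<A>" by (rule Inter_anti_mono)
    then have "carrier R \<inter> \<Inter>(\<A> - {Qs ! k}) \<subseteq> \<Inter>\<A>" using * by auto
    then have "carrier R \<inter> \<Inter>(\<A> - {Qs ! k}) = carrier R \<inter> \<Inter>\<A>" by auto
    then have "card \<A> \<le> card (\<A> - {Qs ! k})" using A by (intro min) auto
    moreover have "Qs ! k \<in> \<A>" using Qs k by auto
    ultimately show False using fin by (metis card_Diff1_less linorder_not_le)
  qed
  then show ?thesis using that[of Qs] Qs(1) A by simp
qed

section \<open>Permuting regular sequences in the Jacobson radical\<close>

locale noetherian_cring = cring R + noetherian_ring R for R (structure)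
begin

text \<open>In a Noetherian ring a nonempty chain of ideals contains its own union, so Zorn's lemma
  applies inside any family of ideals.\<close>

lemma exists_maximal_in_family:
  assumes ne: "\<F> \<noteq> {}" and id: "\<And>J. J \<in> \<F> \<Longrightarrow> ideal J R"
  obtains M where "M \<in> \<F>" "\<forall>J\<in>\<F>. M \<subseteq> J \<longrightarrow> J = M"
proof -
  have "\<exists>M\<in>\<F>. \<forall>K\<in>\<F>. M \<subseteq> K \<longrightarrow> K = M"
  proof (rule subset_Zorn_nonempty[OF ne])
    fix C assume C: "C \<noteq> {}" "subset.chain \<F> C"
    then have "subset.chain {I. ideal I R} C" using id by (auto simp: pred_on.chain_def)
    then have "\<Union>C \<in> C" by (rule ideal_chain_is_trivial[OF C(1)])
    then show "\<Union>C \<in> \<F>" using C(2) by (auto simp: pred_on.chain_def)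
  qed
  then show ?thesis using that by blast
qed

text \<open>The finite generating set is found inside \<open>S\<close>, so a monomial ideal keeps
  monomial generators. It comes from a maximal ideal among those generated by finite subsets of
  \<open>S\<close>.\<close>

lemma genideal_finite_subset:
  assumes S: "S \<subseteq> carrier R"
  obtains F where "F \<subseteq> S" "finite F" "Idl F = Idl S"
proof -
  let ?F = "{Idl F | F. F \<subseteq> S \<and> finite F}"
  have ne: "?F \<noteq> {}" by blast
  have id: "ideal J R" if "J \<in> ?F" for J using that S by (auto intro: genideal_ideal)
  obtain M where M: "M \<in> ?F" and max: "\<forall>J\<in>?F. M \<subseteq> J \<longrightarrow> J = M"
    by (rule exists_maximal_in_family[OF ne id])
  then obtain F where F: "F \<subseteq> S" "finite F" "M = Idl F" by blast
  have "S \<subseteq> M"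
  proof
    fix s assume s: "s \<in> S"
    then have sF: "insert s F \<subseteq> carrier R" using F S by blast
    have "M \<subseteq> Idl (insert s F)" using subset_Idl_subset[OF sF] F by blast
    moreover have "Idl (insert s F) \<in> ?F" using s F by blast
    ultimately have "Idl (insert s F) = M" using max by blast
    then show "s \<in> M" using genideal_self[OF sF] by blast
  qed
  then have "Idl S \<subseteq> Idl F" using F S by (intro genideal_minimal genideal_ideal) auto
  moreover have "Idl F \<subseteq> Idl S" using subset_Idl_subset[OF S F(1)] .
  ultimately show ?thesis using that F by blast
qed

lemma exists_maximalideal_above:
  assumes J: "ideal J R" and ne: "J \<noteq> carrier R"
  obtains M where "maximalideal M R" "J \<subseteq> M"
proof -
  let ?F = "{K. ideal K R \<and> K \<noteq> carrier R \<and> J \<subseteq> K}"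
  have F: "?F \<noteq> {}" "\<And>K. K \<in> ?F \<Longrightarrow> ideal K R" using J ne by auto
  obtain M where M: "M \<in> ?F" and max: "\<forall>K\<in>?F. M \<subseteq> K \<longrightarrow> K = M"
    by (rule exists_maximal_in_family[OF F])
  have "maximalideal M R"
    using M max by (intro maximalidealI) blast+
  then show ?thesis using that M by blast
qed

text \<open>A maximal ideal containing 1 - cy would also contain y, hence 1; so 1 - cy is a
  unit.\<close>

lemma jacobson_radical_cancel:
  assumes y: "y \<in> jacobson_radical R" and c: "c \<in> carrier R" and r: "r \<in> carrier R"
    and J: "ideal J R" and mem: "(\<one> \<ominus> c \<otimes> y) \<otimes> r \<in> J"
  shows "r \<in> J"
proof -
  interpret J: ideal J R by fact
  have yR: "y \<in> carrier R" using y by (simp add: jacobson_radical_def)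
  let ?u = "\<one> \<ominus> c \<otimes> y"
  have u: "?u \<in> carrier R" using c yR by simp
  have "PIdl ?u = carrier R"
  proof (rule ccontr)
    assume "PIdl ?u \<noteq> carrier R"
    then obtain M where M: "maximalideal M R" "PIdl ?u \<subseteq> M"
      using exists_maximalideal_above cgenideal_ideal[OF u] by blast
    interpret M: maximalideal M R by fact
    have "y \<in> M" using y M(1) by (auto simp: jacobson_radical_def)
    then have "c \<otimes> y \<in> M" using c M.I_l_closed by simp
    moreover have "?u \<in> M" using M(2) cgenideal_self[OF u] by blast
    ultimately have "?u \<oplus> c \<otimes> y \<in> M" by simp
    moreover have "?u \<oplus> c \<otimes> y = \<one>" using c yR by algebra
    ultimately show False using M.one_imp_carrier M.I_notcarr by simp
  qed
  then have "\<one> \<in> PIdl ?u" by simp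
  then obtain w where w: "w \<in> carrier R" "\<one> = w \<otimes> ?u" by (auto simp: cgenideal_def)
  have "r = (w \<otimes> ?u) \<otimes> r" using w(2) r by simp
  also have "\<dots> = w \<otimes> (?u \<otimes> r)" using w(1) u r by (simp add: m_assoc)
  finally show ?thesis using J.I_l_closed[OF mem w(1)] by simp
qed

text \<open>
  A form of Krull's intersection theorem: for \<open>r \<in> E\<close> outside \<open>J\<close> with \<open>J + (r)\<close> maximal
  and \<open>r = y r' + j\<close>, maximality puts \<open>r'\<close> into \<open>J + (r)\<close>, so that \<open>(1 - c y) r' \<in> J\<close>.
\<close>
lemma jacobson_divisible_mem:
  assumes y: "y \<in> jacobson_radical R" and J: "ideal J R" and E: "E \<subseteq> carrier R"
    and step: "\<And>r. r \<in> E \<Longrightarrow> \<exists>r'\<in>E. \<exists>j\<in>J. r = j \<oplus> r' \<otimes> y"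
  shows "E \<subseteq> J"
proof (rule ccontr)
  assume "\<not> E \<subseteq> J"
  interpret J: ideal J R by fact
  have yR: "y \<in> carrier R" using y by (simp add: jacobson_radical_def)
  have IJ: "Idl J = J" using genideal_minimal[OF J] genideal_self J.a_subset by blast
  let ?F = "{Idl (insert r J) | r. r \<in> E - J}"
  have ne: "?F \<noteq> {}" using \<open>\<not> E \<subseteq> J\<close> by blast
  have id: "ideal K R" if "K \<in> ?F" for K
    using that E J.a_subset by (auto intro!: genideal_ideal)
  obtain M where M: "M \<in> ?F" and max: "\<forall>K\<in>?F. M \<subseteq> K \<longrightarrow> K = M"
    by (rule exists_maximal_in_family[OF ne id])
  then obtain r where r: "r \<in> E" "r \<notin> J" "M = Idl (insert r J)" by blast
  obtain r' j where r': "r' \<in> E" "j \<in> J" "r = j \<oplus> r' \<otimes> y" using step[OF r(1)] by blast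
  have rR: "r \<in> carrier R" and r'R: "r' \<in> carrier R" and jR: "j \<in> carrier R"
    using r(1) r'(1,2) E J.Icarr by auto
  have "r' \<notin> J"
    using r(2) r' J.I_r_closed[OF _ yR] by auto
  have "r = j \<oplus> y \<otimes> r'" using r'(3) m_comm[OF r'R yR] by simp
  then have "r \<in> Idl (insert r' J)"
    using genideal_insertI[of j J y r'] r'(2) IJ yR r'R J.a_subset by simp
  moreover have sub: "insert r' J \<subseteq> carrier R" using r'R J.a_subset by simp
  moreover have "J \<subseteq> Idl (insert r' J)" using genideal_self[OF sub] by blast
  ultimately have "M \<subseteq> Idl (insert r' J)"
    unfolding r(3) by (intro genideal_minimal genideal_ideal) auto
  then have "Idl (insert r' J) = M" using r'(1) \<open>r' \<notin> J\<close> by (intro max[rule_format]) auto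
  then have "r' \<in> Idl (insert r J)" using genideal_self[OF sub] r(3) by blast
  then obtain k c where k: "k \<in> J" "c \<in> carrier R" "r' = k \<oplus> c \<otimes> r"
    using genideal_insertE[of r' r J] rR J.a_subset IJ by metis
  have kR: "k \<in> carrier R" using k J.Icarr by simp
  have eq: "r' = k \<oplus> c \<otimes> (j \<oplus> r' \<otimes> y)" using k(3) r'(3) by simp
  have "(\<one> \<ominus> c \<otimes> y) \<otimes> r' = r' \<ominus> c \<otimes> r' \<otimes> y" using k(2) yR r'R by algebra
  also have "\<dots> = (k \<oplus> c \<otimes> (j \<oplus> r' \<otimes> y)) \<ominus> c \<otimes> r' \<otimes> y" using eq by simp
  also have "\<dots> = k \<oplus> c \<otimes> j" using k(2) yR r'R kR jR by algebra
  finally have "(\<one> \<ominus> c \<otimes> y) \<otimes> r' \<in> J" using k(1,2) r'(2) J.I_l_closed by simp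
  then have "r' \<in> J" by (rule jacobson_radical_cancel[OF y k(2) r'R J])
  with \<open>r' \<notin> J\<close> show False by simp
qed

section \<open>Descent and exchange of regular elements, descent of primality\<close>

text \<open>Let J = \<open>Idl A\<close> and let E be the colon of J by \<open>z\<close>. Writing r
  in E as u + cy and cancelling y in zr shows that c is in E, so E lies in J + yE and
  \<open>jacobson_divisible_mem\<close> applies. The assumption \<open>mem\<close> is weak enough to
  hold both for regular elements and for elements outside a prime.\<close>

lemma regular_mod_descend:
  assumes A: "A \<subseteq> carrier R" and y: "y \<in> jacobson_radical R" and ry: "regular_mod R (Idl A) y"
    and z: "z \<in> carrier R"
    and mem: "\<And>r. \<lbrakk>r \<in> carrier R; z \<otimes> r \<in> Idl A\<rbrakk> \<Longrightarrow> r \<in> Idl (insert y A)"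
  shows "regular_mod R (Idl A) z"
proof -
  have yR: "y \<in> carrier R" using y by (simp add: jacobson_radical_def)
  interpret J: ideal "Idl A" R by (rule genideal_ideal[OF A])
  let ?E = "{r \<in> carrier R. z \<otimes> r \<in> Idl A}"
  have "?E \<subseteq> Idl A"
  proof (rule jacobson_divisible_mem[OF y J.is_ideal])
    fix r assume "r \<in> ?E"
    then have r: "r \<in> carrier R" "z \<otimes> r \<in> Idl A" by auto
    then obtain u c where u: "u \<in> Idl A" "c \<in> carrier R" "r = u \<oplus> c \<otimes> y"
      using genideal_insertE[OF mem yR A] by blast
    have uR: "u \<in> carrier R" using u J.Icarr by simp
    have "z \<otimes> r = z \<otimes> u \<oplus> y \<otimes> (z \<otimes> c)" unfolding u(3) using u(2) uR z yR by algebra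
    then have "z \<otimes> u \<oplus> y \<otimes> (z \<otimes> c) \<in> Idl A" using r(2) by (rule subst)
    moreover have "y \<otimes> (z \<otimes> c) \<in> carrier R" using u(2) z yR by simp
    ultimately have "y \<otimes> (z \<otimes> c) \<in> Idl A"
      using J.mem_add_cancel J.I_l_closed[OF u(1) z] by blast
    then have "z \<otimes> c \<in> Idl A" by (rule regular_modD[OF ry]) (use u(2) z in simp)
    then show "\<exists>r'\<in>?E. \<exists>j\<in>Idl A. r = j \<oplus> r' \<otimes> y" using u by blast
  qed auto
  then show ?thesis unfolding regular_mod_def by blast
qed

text \<open>The first claim is where the Jacobson radical acts. The second is elementary: if yr = cz
  modulo \<open>A\<close>, then c is a multiple ey of y modulo \<open>A\<close>, and cancelling y
  leaves r = ez modulo \<open>A\<close>.\<close>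

lemma regular_mod_swap:
  assumes A: "A \<subseteq> carrier R" and y: "y \<in> jacobson_radical R" and z: "z \<in> carrier R"
    and ry: "regular_mod R (Idl A) y" and rz: "regular_mod R (Idl (insert y A)) z"
  shows "regular_mod R (Idl A) z" and "regular_mod R (Idl (insert z A)) y"
proof -
  have yR: "y \<in> carrier R" using y by (simp add: jacobson_radical_def)
  interpret J: ideal "Idl A" R by (rule genideal_ideal[OF A])
  have yA: "insert y A \<subseteq> carrier R" using yR A by simp
  have sub: "Idl A \<subseteq> Idl (insert y A)" using subset_Idl_subset[OF yA] by blast
  show "regular_mod R (Idl A) z"
    using rz sub by (intro regular_mod_descend[OF A y ry z]) (auto simp: regular_mod_def)
  show "regular_mod R (Idl (insert z A)) y"
    unfolding regular_mod_def
  proof (intro ballI impI)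
    fix r assume r: "r \<in> carrier R" and "y \<otimes> r \<in> Idl (insert z A)"
    then obtain u c where u: "u \<in> Idl A" "c \<in> carrier R" "y \<otimes> r = u \<oplus> c \<otimes> z"
      using genideal_insertE[OF _ z A] by blast
    have uR: "u \<in> carrier R" using u J.Icarr by simp
    have "z \<otimes> c = (u \<oplus> c \<otimes> z) \<ominus> u" using u(2) uR z by algebra
    also have "\<dots> = \<ominus> u \<oplus> r \<otimes> y" unfolding u(3)[symmetric] using uR r yR by algebra
    finally have "z \<otimes> c \<in> Idl (insert y A)"
      using genideal_insertI[OF _ r yR A] J.a_inv_closed[OF u(1)] by simp
    then have "c \<in> Idl (insert y A)" using regular_modD[OF rz] u(2) by blast
    then obtain v e where v: "v \<in> Idl A" "e \<in> carrier R" "c = v \<oplus> e \<otimes> y"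
      using genideal_insertE[OF _ yR A] by blast
    have vR: "v \<in> carrier R" using v J.Icarr by simp
    have "y \<otimes> (r \<ominus> e \<otimes> z) = y \<otimes> r \<ominus> e \<otimes> y \<otimes> z" using r v(2) z yR by algebra
    also have "\<dots> = u \<oplus> (v \<oplus> e \<otimes> y) \<otimes> z \<ominus> e \<otimes> y \<otimes> z" using u(3) v(3) by simp
    also have "\<dots> = u \<oplus> z \<otimes> v" using uR vR v(2) z yR by algebra
    finally have "y \<otimes> (r \<ominus> e \<otimes> z) \<in> Idl A" using u(1) v(1) z J.I_l_closed by simp
    then have *: "r \<ominus> e \<otimes> z \<in> Idl A" by (rule regular_modD[OF ry]) (use r v(2) z in simp)
    have "r = (r \<ominus> e \<otimes> z) \<oplus> e \<otimes> z" using r v(2) z by algebra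
    then show "r \<in> Idl (insert z A)" using genideal_insertI[OF * v(2) z A] by simp
  qed
qed

text \<open>\<open>regular_mod_descend\<close> is used twice. Elements outside the larger prime are
  regular modulo \<open>Idl A\<close>; so if b is outside \<open>Idl A\<close>, every r with br in
  \<open>Idl A\<close> lies in the larger prime, and the same lemma then makes b regular.\<close>

lemma primeideal_descend:
  assumes A: "A \<subseteq> carrier R" and y: "y \<in> jacobson_radical R"
    and ry: "regular_mod R (Idl A) y" and P: "primeideal (Idl (insert y A)) R"
  shows "primeideal (Idl A) R"
proof -
  have yR: "y \<in> carrier R" using y by (simp add: jacobson_radical_def)
  interpret J: ideal "Idl A" R by (rule genideal_ideal[OF A])
  interpret P: primeideal "Idl (insert y A)" R by fact
  have yA: "insert y A \<subseteq> carrier R" using yR A by simp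
  have sub: "Idl A \<subseteq> Idl (insert y A)" using subset_Idl_subset[OF yA] by blast
  show ?thesis
  proof (rule primeidealI[OF J.is_ideal is_cring])
    show "carrier R \<noteq> Idl A" using sub P.I_notcarr J.a_subset P.a_subset by blast
  next
    fix a b assume a: "a \<in> carrier R" and b: "b \<in> carrier R" and ab: "a \<otimes> b \<in> Idl A"
    have reg: "regular_mod R (Idl A) c" if c: "c \<in> carrier R" "c \<notin> Idl (insert y A)" for c
    proof (rule regular_mod_descend[OF A y ry c(1)])
      fix r assume r: "r \<in> carrier R" "c \<otimes> r \<in> Idl A"
      then have "c \<otimes> r \<in> Idl (insert y A)" using sub by blast
      then show "r \<in> Idl (insert y A)" using P.I_prime[OF c(1) r(1)] c(2) by blast
    qed
    show "a \<in> Idl A \<or> b \<in> Idl A"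
    proof (rule disjCI)
      assume nb: "b \<notin> Idl A"
      have "regular_mod R (Idl A) b"
      proof (rule regular_mod_descend[OF A y ry b])
        fix r assume r: "r \<in> carrier R" "b \<otimes> r \<in> Idl A"
        then have "r \<otimes> b \<in> Idl A" using m_comm[OF b r(1)] by simp
        then show "r \<in> Idl (insert y A)" using regular_modD[OF reg[OF r(1)]] b nb by blast
      qed
      then show "a \<in> Idl A" using regular_modD[of R _ b a] a ab m_comm[OF a b] by simp
    qed
  qed
qed

text \<open>Induction on the initial segment \<open>{1..k}\<close>: the assumption covers the new
  last element over the full segment before it, and exchanges extend this to all subsets.\<close>

lemma regular_sequence_permutable:
  fixes x :: "nat \<Rightarrow> 'a"
  assumes xJ: "x ` {1..d} \<subseteq> jacobson_radical R"
    and reg: "\<And>i. i \<in> {1..d} \<Longrightarrow> regular_mod R (Idl (x ` {1..<i})) (x i)"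
    and "k \<le> d" "T \<subseteq> {1..k}" "i \<in> {1..k} - T"
  shows "regular_mod R (Idl (x ` T)) (x i)"
  using assms(3-5)
proof (induct k arbitrary: T i)
  case 0
  then show ?case by simp
next
  case (Suc k)
  note IHk = Suc.hyps and kd = Suc.prems(1)
  have xJ': "x j \<in> jacobson_radical R" if "j \<in> {1..Suc k}" for j
    using that Suc.prems(1) by (intro subsetD[OF xJ]) auto
  then have xR: "x j \<in> carrier R" if "j \<in> {1..Suc k}" for j
    using that by (simp add: jacobson_radical_def)
  \<comment> \<open>Downward induction from the full set: \<open>x j\<close> is removed from the
    ideal by the first exchange, being regular modulo the smaller ideal by the induction hypothesis
    on \<open>k\<close>.\<close>
  have new: "regular_mod R (Idl (x ` U)) (x (Suc k))" if "U \<subseteq> {1..k}" for U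
    using that
  proof (induct "card ({1..k} - U)" arbitrary: U)
    case 0
    then have "U = {1..<Suc k}" by auto
    then show ?case using reg[of "Suc k"] Suc.prems(1) by simp
  next
    case (Suc n)
    then obtain j where j: "j \<in> {1..k} - U" by (metis card.empty ex_in_conv nat.distinct(1))
    have "{1..k} - insert j U = ({1..k} - U) - {j}" by blast
    then have "n = card ({1..k} - insert j U)" using Suc.hyps(2) j by simp
    then have IH: "regular_mod R (Idl (x ` insert j U)) (x (Suc k))"
      using Suc.prems j by (intro Suc.hyps(1)) auto
    have rj: "regular_mod R (Idl (x ` U)) (x j)"
      using kd Suc.prems j by (intro IHk) auto
    show ?case
      using Suc.prems j xR xJ'
      by (intro regular_mod_swap(1)[OF _ _ _ rj IH[unfolded image_insert]]) auto
  qed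
  show ?case
  proof (cases "i = Suc k")
    case True
    then have "T \<subseteq> {1..k}" using Suc.prems by (auto simp: atLeastAtMostSuc_conv)
    then show ?thesis using new True by simp
  next
    case i: False
    then have ik: "i \<in> {1..k}" using Suc.prems(3) by auto
    define U where "U = T - {Suc k}"
    have U: "U \<subseteq> {1..k}" "i \<notin> U"
      using Suc.prems by (auto simp: U_def atLeastAtMostSuc_conv)
    have ri: "regular_mod R (Idl (x ` U)) (x i)"
      using Suc.hyps[of U i] Suc.prems(1) U ik by simp
    show ?thesis
    proof (cases "Suc k \<in> T")
      case True
      then have T: "T = insert (Suc k) U" by (auto simp: U_def)
      \<comment> \<open>The second exchange, over \<open>U\<close>, moves \<open>x (Suc k)\<close>
        into the ideal past \<open>x i\<close>.\<close>
      have new': "regular_mod R (Idl (x ` insert i U)) (x (Suc k))"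
        using U ik by (intro new) auto
      have "x ` U \<subseteq> carrier R" "x i \<in> jacobson_radical R" "x (Suc k) \<in> carrier R"
        using U(1) ik xR xJ' by auto
      then have "regular_mod R (Idl (insert (x (Suc k)) (x ` U))) (x i)"
        by (rule regular_mod_swap(2)[OF _ _ _ ri new'[unfolded image_insert]])
      then show ?thesis by (simp add: T)
    next
      case False
      then show ?thesis using ri by (simp add: U_def)
    qed
  qed
qed

lemma regular_sequence_subset_primeideal:
  fixes x :: "nat \<Rightarrow> 'a"
  assumes xJ: "x ` {1..d} \<subseteq> jacobson_radical R"
    and reg: "\<And>i. i \<in> {1..d} \<Longrightarrow> regular_mod R (Idl (x ` {1..<i})) (x i)"
    and P: "primeideal (Idl (x ` {1..d})) R"
    and "T \<subseteq> {1..d}"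
  shows "primeideal (Idl (x ` T)) R"
  using assms(4)
proof (induct "card ({1..d} - T)" arbitrary: T)
  case 0
  then have "T = {1..d}" by auto
  then show ?case using P by simp
next
  case (Suc n)
  then obtain j where j: "j \<in> {1..d} - T" by (metis card.empty ex_in_conv nat.distinct(1))
  have "{1..d} - insert j T = ({1..d} - T) - {j}" by blast
  then have "n = card ({1..d} - insert j T)" using Suc.hyps(2) j by simp
  then have IH: "primeideal (Idl (x ` insert j T)) R"
    using Suc.prems j by (intro Suc.hyps(1)) auto
  have "regular_mod R (Idl (x ` T)) (x j)"
    using regular_sequence_permutable[OF xJ reg] Suc.prems j by blast
  moreover have "x ` T \<subseteq> carrier R"
    using xJ Suc.prems unfolding jacobson_radical_def by blast
  moreover have "x j \<in> jacobson_radical R" using xJ j by blast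
  ultimately show ?case using IH[unfolded image_insert] by (metis primeideal_descend)
qed

end

section \<open>Nilpotence modulo an ideal\<close>

lemma (in ideal) add_nat_pow:
  assumes "cring R" and j: "j \<in> I" and y: "y \<in> carrier R"
  shows "\<exists>k\<in>I. (j \<oplus> y) [^] (n::nat) = k \<oplus> y [^] n"
proof (induct n)
  case 0
  show ?case by (intro bexI[of _ \<zero>]) auto
next
  interpret cring R by fact
  case (Suc n)
  then obtain k where k: "k \<in> I" "(j \<oplus> y) [^] n = k \<oplus> y [^] n" by blast
  have jR: "j \<in> carrier R" and kR: "k \<in> carrier R" using j k Icarr by auto
  have "(j \<oplus> y) [^] Suc n = (k \<oplus> y [^] n) \<otimes> (j \<oplus> y)" using k(2) by simp
  also have "\<dots> = (k \<otimes> (j \<oplus> y) \<oplus> y [^] n \<otimes> j) \<oplus> y [^] Suc n"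
    using jR kR y by (simp add: l_distr r_distr a_ac)
  finally show ?case
    using k(1) j y jR I_l_closed I_r_closed
    by (intro bexI[of _ "k \<otimes> (j \<oplus> y) \<oplus> y [^] n \<otimes> j"]) auto
qed

text \<open>The generators are adjoined to \<open>J\<close> one at a time. If b^m lies in (J, y), it
  is cy modulo \<open>J\<close>, and its n-th power lies in \<open>J\<close> as soon as y^n does;
  exponents multiply.\<close>

lemma (in cring) nilpotent_mod_genideal:
  assumes "finite F" "F \<subseteq> carrier R" "ideal J R"
    and "\<And>y. y \<in> F \<Longrightarrow> \<exists>n::nat. n > 0 \<and> y [^] n \<in> J"
    and "b \<in> Idl (J \<union> F)"
  shows "\<exists>n::nat. n > 0 \<and> b [^] n \<in> J"
  using assms
proof (induct F arbitrary: J)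
  case empty
  interpret J: ideal J R by fact
  have "b \<in> J" using empty genideal_minimal[OF J.is_ideal, of J] by auto
  then show ?case using J.Icarr by (intro exI[of _ 1]) auto
next
  case (insert y F)
  interpret J: ideal J R by fact
  have yR: "y \<in> carrier R" using insert.prems(1) by simp
  have sub: "insert y J \<subseteq> carrier R" using yR J.a_subset by simp
  let ?J = "Idl (insert y J)"
  interpret K: ideal ?J R by (rule genideal_ideal[OF sub])
  have JJ: "insert y J \<subseteq> ?J" by (rule genideal_self[OF sub])
  have "?J \<union> F \<subseteq> carrier R" using K.a_subset insert.prems(1) by simp
  then have "Idl (J \<union> insert y F) \<subseteq> Idl (?J \<union> F)" using JJ by (intro subset_Idl_subset) auto
  then have "b \<in> Idl (?J \<union> F)" using insert.prems(4) by blast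
  moreover have "\<exists>n::nat. n > 0 \<and> z [^] n \<in> ?J" if "z \<in> F" for z
    using insert.prems(3)[of z] that JJ by blast
  ultimately obtain m :: nat where m: "m > 0" "b [^] m \<in> ?J"
    using insert.hyps(3)[OF _ K.is_ideal] insert.prems(1) by auto
  have "J \<union> insert y F \<subseteq> carrier R" using J.a_subset insert.prems(1) by simp
  then have bR: "b \<in> carrier R" using insert.prems(4) ideal.Icarr[OF genideal_ideal] by blast
  obtain j c where j: "j \<in> Idl J" "c \<in> carrier R" "b [^] m = j \<oplus> c \<otimes> y"
    using genideal_insertE[OF m(2) yR J.a_subset] by blast
  have jJ: "j \<in> J" using j(1) genideal_minimal[OF J.is_ideal, of J] by auto
  obtain n :: nat where n: "n > 0" "y [^] n \<in> J" using insert.prems(3)[of y] by auto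
  obtain k where k: "k \<in> J" "(j \<oplus> c \<otimes> y) [^] n = k \<oplus> (c \<otimes> y) [^] n"
    using J.add_nat_pow[OF is_cring jJ, of "c \<otimes> y" n] j(2) yR by auto
  have "(c \<otimes> y) [^] n \<in> J"
    using n(2) j(2) yR J.I_l_closed by (simp add: nat_pow_distrib)
  then have "(b [^] m) [^] n \<in> J" using k j(3) by simp
  then have "b [^] (m * n) \<in> J" using bR by (simp add: nat_pow_pow)
  then show ?case using m(1) n(1) by (intro exI[of _ "m * n"]) simp
qed

section \<open>Monomial ideals\<close>

text \<open>Gives the drop of total degree when exponents are lowered. If \<open>f\<close> merges
  elements of \<open>S\<close>, the sum over the image only gets smaller.\<close>

lemma sum_strict_mono_image:
  fixes g :: "'b \<Rightarrow> nat"
  assumes "finite S" "s \<in> S" "g (f s) < g s" "\<And>s. s \<in> S \<Longrightarrow> g (f s) \<le> g s"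
  shows "sum g (f ` S) < sum g S"
proof -
  have "sum g (f ` S) \<le> sum (g \<circ> f) S" using assms(1) by (rule sum_image_le) simp
  also have "\<dots> < sum g S" using assms by (intro sum_strict_mono_ex1) auto
  finally show ?thesis .
qed

text \<open>Exactly what the monomial calculus takes from the regular sequence. For \<open>T\<close>
  empty, \<open>prime\<close> says that \<open>R\<close> is a domain.\<close>

locale prime_variables = cring R for R (structure) +
  fixes D :: "'i set" and x :: "'i \<Rightarrow> 'a"
  assumes finite_D: "finite D"
    and x_closed: "t \<in> D \<Longrightarrow> x t \<in> carrier R"
    and prime: "T \<subseteq> D \<Longrightarrow> primeideal (Idl (x ` T)) R"
    and x_notin: "\<lbrakk>T \<subseteq> D; t \<in> D; t \<notin> T\<rbrakk> \<Longrightarrow> x t \<notin> Idl (x ` T)"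
begin

text \<open>Exponent vectors are total functions whose values off \<open>D\<close> are irrelevant,
  so they are compared on \<open>D\<close> only.\<close>

definition mon :: "('i \<Rightarrow> nat) \<Rightarrow> 'a" where
  "mon a = (\<Otimes>i\<in>D. x i [^] a i)"

definition deg :: "('i \<Rightarrow> nat) \<Rightarrow> nat" where
  "deg a = (\<Sum>i\<in>D. a i)"

text \<open>Indexing generators by exponent vectors lets degrees and divisibility be read off
  without recovering exponents from ring elements.\<close>

definition mon_ideal :: "('i \<Rightarrow> nat) set \<Rightarrow> 'a set" where
  "mon_ideal S = Idl (mon ` S)"

definition single :: "'i \<Rightarrow> nat \<Rightarrow> 'i \<Rightarrow> nat" where
  "single t n = (\<lambda>_. 0)(t := n)"

lemma mon_closed [simp]: "mon a \<in> carrier R"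
  using x_closed by (auto simp: mon_def)

lemma mon_cong: "(\<And>i. i \<in> D \<Longrightarrow> a i = b i) \<Longrightarrow> mon a = mon b"
  unfolding mon_def using x_closed by (intro finprod_cong') auto

lemma mon_add: "mon (\<lambda>i. a i + b i) = mon a \<otimes> mon b"
proof -
  have "mon (\<lambda>i. a i + b i) = (\<Otimes>i\<in>D. x i [^] a i \<otimes> x i [^] b i)"
    unfolding mon_def using x_closed by (intro finprod_cong') (auto simp: nat_pow_mult)
  also have "\<dots> = mon a \<otimes> mon b"
    unfolding mon_def using x_closed by (intro finprod_multf) auto
  finally show ?thesis .
qed

lemma mon_eq_one: "(\<And>i. i \<in> D \<Longrightarrow> a i = 0) \<Longrightarrow> mon a = \<one>"
  unfolding mon_def by (intro finprod_one_eqI) auto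

lemma mon_single: "t \<in> D \<Longrightarrow> mon (single t n) = x t [^] n"
proof -
  assume t: "t \<in> D"
  have "mon (single t n) = (\<Otimes>j\<in>D. if t = j then x j [^] n else \<one>)"
    unfolding mon_def single_def using x_closed by (intro finprod_cong') auto
  also have "\<dots> = x t [^] n" using finite_D t x_closed by (intro finprod_singleton) auto
  finally show ?thesis .
qed

lemma mon_single_1: "t \<in> D \<Longrightarrow> mon (single t 1) = x t"
  using x_closed by (simp add: mon_single)

lemma mon_divides:
  assumes "\<And>i. i \<in> D \<Longrightarrow> a i \<le> b i"
  shows "mon b = mon (\<lambda>i. b i - a i) \<otimes> mon a"
  unfolding mon_add[symmetric] using assms by (intro mon_cong) simp

lemma mon_decr:
  assumes "t \<in> D" "a t > 0"
  shows "mon a = x t \<otimes> mon (a(t := a t - 1))"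
proof -
  have "mon a = mon (\<lambda>i. single t 1 i + (a(t := a t - 1)) i)"
    using assms by (intro mon_cong) (auto simp: single_def)
  then show ?thesis using assms by (simp add: mon_add mon_single_1 del: fun_upd_apply One_nat_def)
qed

lemma deg_eq_0: "deg a = 0 \<longleftrightarrow> (\<forall>i\<in>D. a i = 0)"
  using finite_D by (simp add: deg_def)

lemma deg_posE:
  assumes "deg a > 0"
  obtains t where "t \<in> D" "a t > 0"
proof -
  have "\<exists>t\<in>D. a t \<noteq> 0" using assms deg_eq_0[of a] by auto
  then show ?thesis using that by blast
qed

lemma deg_single [simp]: "t \<in> D \<Longrightarrow> deg (single t n) = n"
  using finite_D by (simp add: deg_def single_def sum.delta')

lemma deg_decr:
  assumes "t \<in> D" "a t > 0"
  shows "deg a = deg (a(t := a t - 1)) + 1"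
proof -
  have "deg a = (\<Sum>i\<in>D. single t 1 i + (a(t := a t - 1)) i)"
    unfolding deg_def using assms(2) by (intro sum.cong) (auto simp: single_def)
  also have "\<dots> = deg (single t 1) + deg (a(t := a t - 1))"
    unfolding deg_def by (rule sum.distrib)
  finally show ?thesis using assms(1) by simp
qed

lemma deg_mono: "(\<And>i. i \<in> D \<Longrightarrow> a i \<le> b i) \<Longrightarrow> deg a \<le> deg b"
  by (simp add: deg_def sum_mono)

lemma deg_strict_mono:
  assumes "\<And>i. i \<in> D \<Longrightarrow> a i \<le> b i" "t \<in> D" "a t < b t"
  shows "deg a < deg b"
  unfolding deg_def using assms finite_D by (intro sum_strict_mono_ex1) auto

lemma mon_image_closed [simp]: "mon ` S \<subseteq> carrier R"
  by auto

lemma ideal_mon_ideal: "ideal (mon_ideal S) R"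
  unfolding mon_ideal_def by (intro genideal_ideal) auto

lemma mon_in_mon_ideal: "s \<in> S \<Longrightarrow> mon s \<in> mon_ideal S"
  unfolding mon_ideal_def using genideal_self[of "mon ` S"] by auto

lemma mon_in_mon_ideal_divisible:
  assumes "s \<in> S" "\<And>i. i \<in> D \<Longrightarrow> s i \<le> a i"
  shows "mon a \<in> mon_ideal S"
proof -
  interpret I: ideal "mon_ideal S" R by (rule ideal_mon_ideal)
  show ?thesis
    using mon_divides[OF assms(2)] mon_in_mon_ideal[OF assms(1)] I.I_l_closed by simp
qed

lemma mon_ideal_leI: "ideal J R \<Longrightarrow> (\<And>s. s \<in> S \<Longrightarrow> mon s \<in> J) \<Longrightarrow> mon_ideal S \<subseteq> J"
  unfolding mon_ideal_def by (intro genideal_minimal) auto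

lemma mon_ideal_subset:
  assumes "\<And>s. s \<in> S \<Longrightarrow> \<exists>u\<in>U. \<forall>i\<in>D. u i \<le> s i"
  shows "mon_ideal S \<subseteq> mon_ideal U"
proof (rule mon_ideal_leI[OF ideal_mon_ideal])
  fix s assume "s \<in> S"
  then obtain u where "u \<in> U" "\<forall>i\<in>D. u i \<le> s i" using assms by blast
  then show "mon s \<in> mon_ideal U" by (intro mon_in_mon_ideal_divisible) auto
qed

lemma mon_ideal_mono: "S \<subseteq> U \<Longrightarrow> mon_ideal S \<subseteq> mon_ideal U"
  by (intro mon_ideal_subset) blast

lemma mon_ideal_subset_image:
  assumes "\<And>s i. \<lbrakk>s \<in> S; i \<in> D\<rbrakk> \<Longrightarrow> g s i \<le> s i"
  shows "mon_ideal S \<subseteq> mon_ideal (g ` S)"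
  using assms by (intro mon_ideal_subset) blast

lemma mon_mult_mon_ideal:
  assumes r: "r \<in> mon_ideal U" and mem: "\<And>u. u \<in> U \<Longrightarrow> m \<otimes> mon u \<in> J"
    and m: "m \<in> carrier R" and J: "ideal J R"
  shows "m \<otimes> r \<in> J"
proof -
  interpret J: ideal J R by fact
  have I: "ideal (mon_ideal U) R" by (rule ideal_mon_ideal)
  from r mon_image_closed[of U] show ?thesis unfolding mon_ideal_def
  proof (induct rule: genideal_induct)
    case zero
    then show ?case using m by simp
  next
    case (gen c s)
    then obtain u where u: "u \<in> U" "s = mon u" by auto
    then have "m \<otimes> (c \<otimes> s) = c \<otimes> (m \<otimes> s)" using gen(1) m by (simp add: m_lcomm)
    then show ?case using mem[OF u(1)] u(2) gen(1) J.I_l_closed by simp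
  next
    case (add u v)
    then have "u \<in> carrier R" "v \<in> carrier R"
      using ideal.Icarr[OF I] unfolding mon_ideal_def by auto
    then show ?case using add m by (simp add: r_distr)
  qed
qed

lemma mon_ideal_single: "T \<subseteq> D \<Longrightarrow> mon_ideal ((\<lambda>t. single t (f t)) ` T) = Idl ((\<lambda>t. x t [^] f t) ` T)"
  unfolding mon_ideal_def image_image
  by (intro arg_cong[of _ _ "genideal R"] image_cong) (auto simp: mon_single)

lemma mon_ideal_variables: "T \<subseteq> D \<Longrightarrow> mon_ideal ((\<lambda>t. single t 1) ` T) = Idl (x ` T)"
  unfolding mon_ideal_def image_image
  by (intro arg_cong[of _ _ "genideal R"] image_cong) (auto simp: mon_single_1 simp del: One_nat_def)

text \<open>A monomial of positive degree is divisible by a variable, so the ideal lies in the prime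
  generated by all variables.\<close>

lemma one_notin_mon_ideal:
  assumes "\<And>s. s \<in> S \<Longrightarrow> deg s > 0"
  shows "\<one> \<notin> mon_ideal S"
proof -
  interpret P: primeideal "Idl (x ` D)" R by (rule prime) simp
  have "mon_ideal S \<subseteq> mon_ideal ((\<lambda>t. single t 1) ` D)"
  proof (rule mon_ideal_subset)
    fix s assume "s \<in> S"
    then obtain t where "t \<in> D" "s t > 0" using assms deg_posE by blast
    then show "\<exists>u\<in>(\<lambda>t. single t 1) ` D. \<forall>i\<in>D. u i \<le> s i"
      by (auto simp: single_def intro!: bexI[of _ t])
  qed
  then show ?thesis
    using mon_ideal_variables[of D] P.one_imp_carrier P.I_notcarr by auto
qed

text \<open>The second ideal uses all of \<open>S\<close>: truncated subtraction keeps the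
  generators free of \<open>x t\<close>, so it contains the original ideal and is the expected colon
  by \<open>x t\<close>.\<close>

lemma mon_ideal_split:
  assumes t: "t \<in> D" and r: "r \<in> mon_ideal S"
  obtains b c where "b \<in> mon_ideal {s \<in> S. s t = 0}" "c \<in> mon_ideal ((\<lambda>s. s(t := s t - 1)) ` S)"
    "r = b \<oplus> x t \<otimes> c"
proof -
  define B where "B = mon_ideal {s \<in> S. s t = 0}"
  define C where "C = mon_ideal ((\<lambda>s. s(t := s t - 1)) ` S)"
  interpret B: ideal B R unfolding B_def by (rule ideal_mon_ideal)
  interpret C: ideal C R unfolding C_def by (rule ideal_mon_ideal)
  have xt: "x t \<in> carrier R" using t x_closed by simp
  from r mon_image_closed[of S] have "\<exists>b\<in>B. \<exists>c\<in>C. r = b \<oplus> x t \<otimes> c" unfolding mon_ideal_def[of S]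
  proof (induct rule: genideal_induct)
    case zero
    then show ?case using xt by (intro bexI[of _ \<zero>]) auto
  next
    case (gen k m)
    then obtain s where s: "s \<in> S" "m = mon s" by auto
    show ?case
    proof (cases "s t = 0")
      case True
      then have "k \<otimes> m \<in> B" using s gen(1) by (intro B.I_l_closed) (auto simp: B_def intro: mon_in_mon_ideal)
      then show ?thesis using xt B.Icarr by (intro bexI[of _ "k \<otimes> m"] bexI[of _ \<zero>]) auto
    next
      case False
      let ?s = "s(t := s t - 1)"
      have "k \<otimes> mon ?s \<in> C" using s gen(1) by (intro C.I_l_closed) (auto simp: C_def simp del: fun_upd_apply intro: mon_in_mon_ideal)
      moreover have "k \<otimes> m = x t \<otimes> (k \<otimes> mon ?s)"
        using mon_decr[OF t, of s] False s(2) gen(1) xt by (simp add: m_lcomm)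
      ultimately show ?thesis using xt C.Icarr by (intro bexI[of _ \<zero>] bexI[of _ "k \<otimes> mon ?s"]) auto
    qed
  next
    case (add u v)
    then obtain b c b' c' where *: "b \<in> B" "c \<in> C" "u = b \<oplus> x t \<otimes> c"
      "b' \<in> B" "c' \<in> C" "v = b' \<oplus> x t \<otimes> c'" by blast
    then have "u \<oplus> v = (b \<oplus> b') \<oplus> x t \<otimes> (c \<oplus> c')"
      using xt B.Icarr C.Icarr by (simp add: r_distr a_ac)
    then show ?case using *(1,2,4,5) by (intro bexI[of _ "b \<oplus> b'"] bexI[of _ "c \<oplus> c'"]) auto
  qed
  then show ?thesis using that unfolding B_def C_def by blast
qed

section \<open>Regular elements modulo monomial ideals\<close>

lemma le_single_if_deg_le_1:
  assumes "deg s \<le> 1" "t \<in> D" "s t > 0" "i \<in> D"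
  shows "s i \<le> single t 1 i"
proof (rule ccontr)
  assume "\<not> s i \<le> single t 1 i"
  then have "deg (single t 1) < deg s"
    using assms(3,4) by (intro deg_strict_mono[of _ _ i]) (auto simp: single_def)
  then show False using assms(1,2) by simp
qed

text \<open>The base case of \<open>mon_ideal_regular\<close>: generators of degree one are
  variables, so the ideal is prime.\<close>

lemma mon_ideal_linear:
  assumes "\<And>s. s \<in> S \<Longrightarrow> deg s = 1"
  shows "mon_ideal S = Idl (x ` {t \<in> D. \<exists>s\<in>S. s t > 0})"
proof -
  let ?W = "{t \<in> D. \<exists>s\<in>S. s t > 0}"
  have "mon_ideal S = mon_ideal ((\<lambda>t. single t 1) ` ?W)"
  proof (intro equalityI mon_ideal_subset)
    fix s assume s: "s \<in> S"
    obtain t where "t \<in> D" "s t > 0" by (rule deg_posE[of s]) (use assms[OF s] in simp)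
    then show "\<exists>u\<in>(\<lambda>t. single t 1) ` ?W. \<forall>i\<in>D. u i \<le> s i"
      using s by (auto simp: single_def intro!: bexI[of _ t])
  next
    fix u assume "u \<in> (\<lambda>t. single t 1) ` ?W"
    then obtain t s where "t \<in> D" "s \<in> S" "s t > 0" "u = single t 1" by blast
    then show "\<exists>s\<in>S. \<forall>i\<in>D. s i \<le> u i"
      using le_single_if_deg_le_1 assms by (intro bexI[of _ s]) auto
  qed
  then show ?thesis using mon_ideal_variables[of ?W] by simp
qed

text \<open>
  The associated primes of a monomial ideal in the variables \<open>T\<close> lie below \<open>(x\<^sub>t : t \<in> T)\<close>.
  If \<open>x\<^sub>t\<close> divides a generator of degree at least 2, split the generators into those free of
  \<open>x\<^sub>t\<close>, generating \<open>B\<close>, and the rest; both \<open>B + (x\<^sub>t)\<close> and the ideal obtained from dividing by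
  \<open>x\<^sub>t\<close> have generators of smaller total degree.
\<close>
lemma mon_ideal_regular:
  assumes "finite S" "T \<subseteq> D" "\<And>s i. \<lbrakk>s \<in> S; i \<in> D - T\<rbrakk> \<Longrightarrow> s i = 0"
    and "b \<in> carrier R" "b \<notin> Idl (x ` T)" "r \<in> carrier R" "b \<otimes> r \<in> mon_ideal S"
  shows "r \<in> mon_ideal S"
  using assms
proof (induct "sum deg S" arbitrary: S T b r rule: less_induct)
  case less
  note fin = less.prems(1) and TD = less.prems(2) and supp = less.prems(3)
    and bR = less.prems(4) and bT = less.prems(5) and rR = less.prems(6) and br = less.prems(7)
  interpret I: ideal "mon_ideal S" R by (rule ideal_mon_ideal)
  consider s where "s \<in> S" "deg s = 0" | "\<And>s. s \<in> S \<Longrightarrow> deg s = 1" | s where "s \<in> S" "deg s \<ge> 2"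
    by (metis One_nat_def less_2_cases not_less)
  then show ?case
  proof cases
    case 1
    then have "\<one> \<in> mon_ideal S" using mon_in_mon_ideal[of s S] mon_eq_one[of s] deg_eq_0[of s] by simp
    then show ?thesis using rR I.one_imp_carrier by simp
  next
    case 2
    let ?W = "{t \<in> D. \<exists>s\<in>S. s t > 0}"
    have eq: "mon_ideal S = Idl (x ` ?W)" using 2 by (rule mon_ideal_linear)
    interpret P: primeideal "Idl (x ` ?W)" R by (rule prime) blast
    have "?W \<subseteq> T" using supp by fastforce
    then have "Idl (x ` ?W) \<subseteq> Idl (x ` T)"
      using TD x_closed by (intro subset_Idl_subset) auto
    then show ?thesis using P.I_prime[OF bR rR] br bT unfolding eq by blast
  next
    case (3 s)
    obtain t where t: "t \<in> D" "s t > 0" by (rule deg_posE[of s]) (use 3(2) in simp)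
    have tT: "t \<in> T" using supp[OF 3(1), of t] t by auto
    have xt: "x t \<in> carrier R" using t x_closed by simp
    define B where "B = {s \<in> S. s t = 0}"
    define C where "C = (\<lambda>s. s(t := s t - 1)) ` S"
    have BS: "B \<subseteq> S" and finB: "finite B" and finC: "finite C"
      using fin by (auto simp: B_def C_def)
    have "sum deg (insert s B) \<le> sum deg S" using fin 3(1) BS by (intro sum_mono2) auto
    \<comment> \<open>The generator \<open>s\<close> is not in \<open>B\<close> and has degree at
      least 2, so adding \<open>x t\<close>, of degree 1, to \<open>B\<close> still lowers the total
      degree.\<close>
    then have B_less: "sum deg B + 2 \<le> sum deg S" using t 3(2) finB by (simp add: B_def)
    have "deg (single t 1) = 1" using t by simp
    then have Bt_less: "sum deg (insert (single t 1) B) < sum deg S"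
      using B_less finB sum.insert_if[OF finB, of deg "single t 1"] by (simp split: if_splits)
    have C_less: "sum deg C < sum deg S" unfolding C_def
      using fin 3(1) t by (intro sum_strict_mono_image) (auto intro: deg_mono deg_strict_mono[of _ _ t])
    interpret IB: ideal "mon_ideal B" R by (rule ideal_mon_ideal)
    interpret IC: ideal "mon_ideal C" R by (rule ideal_mon_ideal)
    have "mon_ideal S \<subseteq> mon_ideal C" unfolding C_def by (intro mon_ideal_subset_image) simp
    then have BC: "mon_ideal B \<subseteq> mon_ideal C" using mon_ideal_mono[OF BS] by blast
    have "mon_ideal S \<subseteq> mon_ideal (insert (single t 1) B)"
    proof (rule mon_ideal_subset)
      fix s assume "s \<in> S"
      then show "\<exists>u\<in>insert (single t 1) B. \<forall>i\<in>D. u i \<le> s i"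
        by (cases "s t = 0") (auto simp: B_def single_def)
    qed
    then have "r \<in> mon_ideal (insert (single t 1) B)"
      using br finB TD supp BS tT
      by (intro less.hyps[OF Bt_less _ TD _ bR bT rR]) (auto simp: single_def)
    then have "r \<in> Idl (insert (x t) (mon ` B))"
      using t by (simp add: mon_ideal_def mon_single_1 del: One_nat_def)
    then obtain b0 c0 where r: "b0 \<in> mon_ideal B" "c0 \<in> carrier R" "r = b0 \<oplus> c0 \<otimes> x t"
      using genideal_insertE[OF _ xt mon_image_closed] unfolding mon_ideal_def by blast
    obtain b1 c1 where b1: "b1 \<in> mon_ideal B" "c1 \<in> mon_ideal C" "b \<otimes> r = b1 \<oplus> x t \<otimes> c1"
      using mon_ideal_split[OF t(1) br] unfolding B_def C_def by blast
    have cR: "b0 \<in> carrier R" "b1 \<in> carrier R" "c1 \<in> carrier R"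
      using r(1) b1(1,2) IB.Icarr IC.Icarr by auto
    \<comment> \<open>The two expressions for br, from the splitting and from r = b0 + c0 x_t, are
      compared modulo \<open>B\<close>.\<close>
    have "x t \<otimes> (b \<otimes> c0 \<ominus> c1) = b \<otimes> (b0 \<oplus> c0 \<otimes> x t) \<ominus> b \<otimes> b0 \<ominus> x t \<otimes> c1"
      using cR r(2) bR xt by algebra
    also have "\<dots> = (b1 \<oplus> x t \<otimes> c1) \<ominus> b \<otimes> b0 \<ominus> x t \<otimes> c1"
      unfolding b1(3)[symmetric] r(3)[symmetric] ..
    also have "\<dots> = b1 \<oplus> b \<otimes> (\<ominus> b0)" using cR bR xt by algebra
    finally have "x t \<otimes> (b \<otimes> c0 \<ominus> c1) \<in> mon_ideal B"
      using b1(1) r(1) bR IB.I_l_closed by simp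
    moreover have "x t \<notin> Idl (x ` (T - {t}))" using TD t by (intro x_notin) auto
    moreover have "s i = 0" if "s \<in> B" "i \<in> D - (T - {t})" for s i
      using that supp by (auto simp: B_def)
    \<comment> \<open>The induction hypothesis for \<open>B\<close>, with \<open>x t\<close> in the
      role of \<open>b\<close>: the generators in \<open>B\<close> avoid \<open>x t\<close>, which
      lies outside the prime of \<open>T - {t}\<close>.\<close>
    ultimately have "b \<otimes> c0 \<ominus> c1 \<in> mon_ideal B"
      using finB TD B_less xt bR r(2) cR
      by (rule_tac less.hyps[of B "T - {t}" "x t"]) auto
    then have "(b \<otimes> c0 \<ominus> c1) \<oplus> c1 \<in> mon_ideal C" using BC b1(2) by auto
    moreover have "(b \<otimes> c0 \<ominus> c1) \<oplus> c1 = b \<otimes> c0" using bR r(2) cR by algebra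
    ultimately have "b \<otimes> c0 \<in> mon_ideal C" by simp
    then have c0: "c0 \<in> mon_ideal C"
      using supp tT by (intro less.hyps[OF C_less finC TD _ bR bT r(2)]) (auto simp: C_def)
    have "x t \<otimes> c0 \<in> mon_ideal S"
    proof (rule mon_mult_mon_ideal[OF c0 _ xt I.is_ideal])
      fix u assume "u \<in> C"
      then obtain s where s: "s \<in> S" "u = s(t := s t - 1)" by (auto simp: C_def)
      have "x t \<otimes> mon u = mon (\<lambda>i. single t 1 i + u i)" using t by (simp add: mon_add mon_single_1 del: One_nat_def)
      also have "\<dots> \<in> mon_ideal S"
        using s by (intro mon_in_mon_ideal_divisible[of s]) (auto simp: single_def)
      finally show "x t \<otimes> mon u \<in> mon_ideal S" .
    qed
    moreover have "b0 \<in> mon_ideal S" using r(1) mon_ideal_mono[OF BS] by blast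
    ultimately show ?thesis using r(3) m_comm[OF r(2) xt] by simp
  qed
qed

section \<open>Colon ideals and membership of monomials\<close>

text \<open>If x_t r = b + x_t c is the splitting, then x_t (r - c) lies in the ideal of the
  generators free of \<open>x t\<close>, modulo which \<open>x t\<close> is regular.\<close>

lemma mon_ideal_colon_variable:
  assumes fin: "finite S" and t: "t \<in> D" and r: "r \<in> carrier R" "x t \<otimes> r \<in> mon_ideal S"
  shows "r \<in> mon_ideal ((\<lambda>s. s(t := s t - 1)) ` S)"
proof -
  define B where "B = {s \<in> S. s t = 0}"
  define C where "C = (\<lambda>s. s(t := s t - 1)) ` S"
  interpret IB: ideal "mon_ideal B" R by (rule ideal_mon_ideal)
  interpret IC: ideal "mon_ideal C" R by (rule ideal_mon_ideal)
  have xt: "x t \<in> carrier R" using t x_closed by simp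
  obtain b c where bc: "b \<in> mon_ideal B" "c \<in> mon_ideal C" "x t \<otimes> r = b \<oplus> x t \<otimes> c"
    using mon_ideal_split[OF t r(2)] unfolding B_def C_def by blast
  have cR: "b \<in> carrier R" "c \<in> carrier R" using bc IB.Icarr IC.Icarr by auto
  have "x t \<otimes> (r \<ominus> c) = x t \<otimes> r \<ominus> x t \<otimes> c" using xt r(1) cR by algebra
  also have "\<dots> = (b \<oplus> x t \<otimes> c) \<ominus> x t \<otimes> c" unfolding bc(3) ..
  also have "\<dots> = b" using xt cR by algebra
  finally have "x t \<otimes> (r \<ominus> c) \<in> mon_ideal B" using bc(1) by simp
  moreover have "x t \<notin> Idl (x ` (D - {t}))" using t by (intro x_notin) auto
  moreover have "s i = 0" if "s \<in> B" "i \<in> D - (D - {t})" for s i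
    using that by (auto simp: B_def)
  moreover have "finite B" using fin by (simp add: B_def)
  ultimately have "r \<ominus> c \<in> mon_ideal B"
    using xt r(1) cR by (rule_tac mon_ideal_regular[of B "D - {t}" "x t"]) auto
  moreover have "mon_ideal B \<subseteq> mon_ideal S" by (intro mon_ideal_mono) (auto simp: B_def)
  moreover have "mon_ideal S \<subseteq> mon_ideal C" unfolding C_def by (intro mon_ideal_subset_image) simp
  ultimately have "(r \<ominus> c) \<oplus> c \<in> mon_ideal C" using bc(2) by auto
  moreover have "(r \<ominus> c) \<oplus> c = r" using r(1) cR by algebra
  ultimately show ?thesis by (simp add: C_def)
qed

text \<open>One variable is divided out at a time. The truncated difference \<open>s i - a i\<close>
  is the exponent of s / gcd(s, a), the colon generator familiar from polynomial rings.\<close>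

lemma mon_ideal_colon:
  assumes "finite S" "r \<in> carrier R" "mon a \<otimes> r \<in> mon_ideal S"
  shows "r \<in> mon_ideal ((\<lambda>s i. s i - a i) ` S)"
  using assms
proof (induct "deg a" arbitrary: a S)
  case 0
  then have a: "a i = 0" if "i \<in> D" for i using that deg_eq_0[of a] by simp
  then have "r \<in> mon_ideal S" using mon_eq_one[of a] 0 by simp
  moreover have "mon_ideal S \<subseteq> mon_ideal ((\<lambda>s i. s i - a i) ` S)"
    by (intro mon_ideal_subset_image) simp
  ultimately show ?case by blast
next
  case (Suc n)
  obtain t where t: "t \<in> D" "a t > 0" by (rule deg_posE[of a]) (use Suc.hyps(2) in simp)
  let ?a = "a(t := a t - 1)"
  have xt: "x t \<in> carrier R" using t x_closed by simp
  have n: "n = deg ?a" using Suc.hyps(2) deg_decr[of t a] t by linarith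
  have "x t \<otimes> (mon ?a \<otimes> r) = (x t \<otimes> mon ?a) \<otimes> r"
    using Suc.prems(2) xt by (simp add: m_assoc del: fun_upd_apply)
  also have "\<dots> = mon a \<otimes> r" using mon_decr[of t a] t by simp
  finally have "x t \<otimes> (mon ?a \<otimes> r) \<in> mon_ideal S" using Suc.prems(3) by simp
  then have "mon ?a \<otimes> r \<in> mon_ideal ((\<lambda>s. s(t := s t - 1)) ` S)"
    using Suc.prems(1,2) t(1) by (rule_tac mon_ideal_colon_variable) auto
  then have "r \<in> mon_ideal ((\<lambda>s i. s i - ?a i) ` (\<lambda>s. s(t := s t - 1)) ` S)"
    using Suc.prems(1,2) by (rule_tac Suc.hyps(1)[OF n]) auto
  \<comment> \<open>The truncated subtractions compose because \<open>a t > 0\<close>.\<close>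
  moreover have "(\<lambda>i. (s(t := s t - 1)) i - ?a i) = (\<lambda>i. s i - a i)" for s
    using t by auto
  ultimately show ?case by (simp only: image_image)
qed

text \<open>Taking the colon by the monomial itself puts 1 into the ideal of the differences, so one
  of these has degree 0.\<close>

lemma mon_mem_mon_ideal:
  assumes "finite S" "mon a \<in> mon_ideal S"
  obtains s where "s \<in> S" "\<And>i. i \<in> D \<Longrightarrow> s i \<le> a i"
proof -
  have "\<one> \<in> mon_ideal ((\<lambda>s i. s i - a i) ` S)"
    using assms by (rule_tac mon_ideal_colon) auto
  then obtain s where "s \<in> S" "deg (\<lambda>i. s i - a i) = 0"
    using one_notin_mon_ideal[of "(\<lambda>s i. s i - a i) ` S"] by auto
  then show ?thesis using that[of s] by (simp add: deg_eq_0)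
qed

section \<open>Pure power ideals\<close>

text \<open>Exponents are attached to the variables themselves, which frees the algebra from
  permutations; \<open>pure_power_ideal_iff\<close> translates.\<close>

definition pure_power :: "'i set \<Rightarrow> ('i \<Rightarrow> nat) \<Rightarrow> 'a set" where
  "pure_power W f = Idl ((\<lambda>t. x t [^] f t) ` W)"

definition pure_powers :: "'a set set" where
  "pure_powers = {pure_power W f | W f. W \<subseteq> D \<and> W \<noteq> {} \<and> (\<forall>t\<in>W. f t > 0)}"

lemma pure_power_eq: "W \<subseteq> D \<Longrightarrow> pure_power W f = mon_ideal ((\<lambda>t. single t (f t)) ` W)"
  by (simp add: pure_power_def mon_ideal_single)

lemma pure_powersE:
  assumes "Q \<in> pure_powers"
  obtains W f where "W \<subseteq> D" "W \<noteq> {}" "\<forall>t\<in>W. f t > 0" "Q = pure_power W f"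
  using assms unfolding pure_powers_def by blast

text \<open>If b lies in the prime generated by the variables in \<open>W\<close>, some power of b
  is in the ideal because each of these variables is nilpotent modulo it. Otherwise b is regular
  modulo the ideal and cancels from ab.\<close>

lemma primaryideal_pure_power:
  assumes W: "W \<subseteq> D" and f: "\<And>t. t \<in> W \<Longrightarrow> f t > 0"
  shows "primaryideal (pure_power W f) R"
proof -
  let ?S = "(\<lambda>t. single t (f t)) ` W"
  have eq: "pure_power W f = mon_ideal ?S" using W by (rule pure_power_eq)
  have finW: "finite W" using W finite_D finite_subset by blast
  interpret Q: ideal "pure_power W f" R unfolding eq by (rule ideal_mon_ideal)
  have "\<one> \<notin> pure_power W f" unfolding eq using W f by (intro one_notin_mon_ideal) auto
  then have ne: "carrier R \<noteq> pure_power W f" by auto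
  have "a \<in> pure_power W f \<or> (\<exists>n::nat. n > 0 \<and> b [^] n \<in> pure_power W f)"
    if a: "a \<in> carrier R" and b: "b \<in> carrier R" and ab: "a \<otimes> b \<in> pure_power W f" for a b
  proof (cases "b \<in> Idl (x ` W)")
    case True
    have W': "x ` W \<subseteq> carrier R" using W x_closed by blast
    then have "Idl (x ` W) \<subseteq> Idl (pure_power W f \<union> x ` W)"
      using Q.a_subset by (intro subset_Idl_subset) auto
    moreover have "\<exists>n::nat. n > 0 \<and> y [^] n \<in> pure_power W f" if "y \<in> x ` W" for y
    proof -
      from that obtain t where t: "t \<in> W" "y = x t" by blast
      then have "x t [^] f t \<in> pure_power W f"
        unfolding eq using W mon_single[of t "f t"] mon_in_mon_ideal[of "single t (f t)" ?S] by auto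
      then show ?thesis using f t by blast
    qed
    ultimately show ?thesis
      using nilpotent_mod_genideal[OF _ W' Q.is_ideal] finW True by blast
  next
    case False
    have "b \<otimes> a \<in> mon_ideal ?S" using ab m_comm[OF a b] eq by simp
    then have "a \<in> mon_ideal ?S"
      using finW W b False a
      by (rule_tac mon_ideal_regular[of ?S W b]) (auto simp: single_def)
    then show ?thesis using eq by simp
  qed
  then show ?thesis
    using ne by (intro primaryideal.intro primaryideal_axioms.intro Q.is_ideal is_cring)
qed

lemma pure_powers_Inter_le:
  assumes fin: "finite \<Q>" and Q: "\<Q> \<subseteq> pure_powers" and P: "P \<in> pure_powers"
    and sub: "carrier R \<inter> \<Inter>\<Q> \<subseteq> P"
  shows "\<exists>Q\<in>\<Q>. Q \<subseteq> P"
proof (rule ccontr)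
  assume neg: "\<not> (\<exists>Q\<in>\<Q>. Q \<subseteq> P)"
  obtain W f where W: "W \<subseteq> D" "\<And>t. t \<in> W \<Longrightarrow> f t > 0" and Peq: "P = pure_power W f"
    using P by (blast elim: pure_powersE)
  have finW: "finite W" using W finite_D finite_subset by blast
  have P': "P = mon_ideal ((\<lambda>t. single t (f t)) ` W)" using Peq W pure_power_eq by simp
  have "\<exists>t n. t \<in> D \<and> mon (single t n) \<in> Q \<and> mon (single t n) \<notin> P" if "Q \<in> \<Q>" for Q
  proof -
    have "Q \<in> pure_powers" using Q that by blast
    then obtain V g where V: "V \<subseteq> D" "Q = pure_power V g" by (rule pure_powersE) blast
    then have Q': "Q = mon_ideal ((\<lambda>t. single t (g t)) ` V)" using pure_power_eq by simp
    have "\<not> Q \<subseteq> P" using neg that by blast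
    moreover have "ideal P R" unfolding P' by (rule ideal_mon_ideal)
    ultimately have "\<exists>t\<in>V. mon (single t (g t)) \<notin> P"
      using mon_ideal_leI[of P "(\<lambda>t. single t (g t)) ` V"] Q' by auto
    then obtain t where t: "t \<in> V" "mon (single t (g t)) \<notin> P" by blast
    then have "mon (single t (g t)) \<in> Q" unfolding Q' by (intro mon_in_mon_ideal imageI)
    then show ?thesis using t V(1) by (intro exI[of _ t] exI[of _ "g t"]) auto
  qed
  then obtain \<tau> \<nu> where *: "\<And>Q. Q \<in> \<Q> \<Longrightarrow> \<tau> Q \<in> D \<and> mon (single (\<tau> Q) (\<nu> Q)) \<in> Q
      \<and> mon (single (\<tau> Q) (\<nu> Q)) \<notin> P" by metis
  \<comment> \<open>On \<open>W\<close>, \<open>f i - 1\<close> is the largest exponent that avoids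
    \<open>P\<close>. Off \<open>W\<close> exponents do not affect membership in \<open>P\<close>,
    and the sum is simply a common upper bound for the chosen ones.\<close>
  define a where "a i = (if i \<in> W then f i - 1 else \<Sum>Q\<in>\<Q>. if \<tau> Q = i then \<nu> Q else 0)" for i
  have "mon a \<in> Q" if QQ: "Q \<in> \<Q>" for Q
  proof -
    have "Q \<in> pure_powers" using Q QQ by blast
    then obtain V g where "V \<subseteq> D" "Q = pure_power V g" by (rule pure_powersE) blast
    then interpret Q: ideal Q R using pure_power_eq ideal_mon_ideal by simp
    have "\<nu> Q \<le> a (\<tau> Q)"
    proof (cases "\<tau> Q \<in> W")
      case True
      \<comment> \<open>A chosen power of a variable in \<open>W\<close> lies outside
        \<open>P\<close>, so its exponent is at most \<open>f - 1\<close> there.\<close>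
      have "\<not> f (\<tau> Q) \<le> \<nu> Q"
      proof
        assume "f (\<tau> Q) \<le> \<nu> Q"
        then have "mon (single (\<tau> Q) (\<nu> Q)) \<in> P" unfolding P' using True
          by (intro mon_in_mon_ideal_divisible[of "single (\<tau> Q) (f (\<tau> Q))"]) (auto simp: single_def)
        then show False using *[OF QQ] by blast
      qed
      then show ?thesis using True by (simp add: a_def)
    next
      case False
      have "(if \<tau> Q = \<tau> Q then \<nu> Q else 0) \<le> (\<Sum>Q'\<in>\<Q>. if \<tau> Q' = \<tau> Q then \<nu> Q' else 0)"
        using QQ fin by (intro member_le_sum) auto
      then show ?thesis using False by (simp add: a_def)
    qed
    then have "mon a = mon (\<lambda>i. a i - single (\<tau> Q) (\<nu> Q) i) \<otimes> mon (single (\<tau> Q) (\<nu> Q))"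
      by (intro mon_divides) (auto simp: single_def)
    then show ?thesis using *[OF QQ] Q.I_l_closed by simp
  qed
  then have "mon a \<in> P" using sub by auto
  then obtain t where "t \<in> W" "\<And>i. i \<in> D \<Longrightarrow> single t (f t) i \<le> a i"
    using finW mon_mem_mon_ideal[of "(\<lambda>t. single t (f t)) ` W" a] P' by blast
  then have "f t \<le> f t - 1" using W(1) by (fastforce simp: single_def a_def)
  then show False using W(2)[OF \<open>t \<in> W\<close>] by simp
qed

section \<open>Splitting generators into pure powers\<close>

text \<open>Modulo \<open>S\<close>, an element of the intersection is x^u c with c in the colon of
  (S, x^v) by x^u. Multiplying the colon generators back by x^u gives multiples of x^s for s in
  \<open>S\<close> and, by disjoint supports, x^(u+v) from v.\<close>

lemma mon_ideal_insert_Int: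
  assumes fin: "finite S" and disj: "\<And>i. i \<in> D \<Longrightarrow> u i = 0 \<or> v i = 0"
  shows "mon_ideal (insert u S) \<inter> mon_ideal (insert v S) = mon_ideal (insert (\<lambda>i. u i + v i) S)"
    (is "?U \<inter> ?V = ?I")
proof
  interpret I: ideal ?I R by (rule ideal_mon_ideal)
  interpret V: ideal ?V R by (rule ideal_mon_ideal)
  interpret IS: ideal "mon_ideal S" R by (rule ideal_mon_ideal)
  have SI: "mon_ideal S \<subseteq> ?I" and SV: "mon_ideal S \<subseteq> ?V" by (intro mon_ideal_mono; blast)+
  show "?I \<subseteq> ?U \<inter> ?V"
    by (intro Int_greatest mon_ideal_subset) auto
  show "?U \<inter> ?V \<subseteq> ?I"
  proof
    fix r assume r: "r \<in> ?U \<inter> ?V"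
    then have "r \<in> Idl (insert (mon u) (mon ` S))" by (simp add: mon_ideal_def)
    then obtain g c where g: "g \<in> mon_ideal S" "c \<in> carrier R" "r = g \<oplus> c \<otimes> mon u"
      using genideal_insertE[OF _ mon_closed mon_image_closed] unfolding mon_ideal_def by blast
    have gR: "g \<in> carrier R" using g(1) IS.Icarr by simp
    have eq: "r = g \<oplus> mon u \<otimes> c" using g(2,3) m_comm[of c "mon u"] by simp
    have "mon u \<otimes> c \<in> ?V"
    proof (rule V.mem_add_cancel)
      show "g \<oplus> mon u \<otimes> c \<in> ?V" using r eq by simp
      show "g \<in> ?V" using g(1) SV by blast
    qed (use g(2) in simp)
    then have c: "c \<in> mon_ideal ((\<lambda>s i. s i - u i) ` insert v S)"
      using fin g(2) by (rule_tac mon_ideal_colon) auto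
    have "mon u \<otimes> c \<in> ?I"
    proof (rule mon_mult_mon_ideal[OF c _ mon_closed I.is_ideal])
      fix w assume "w \<in> (\<lambda>s i. s i - u i) ` insert v S"
      then obtain s where s: "s \<in> insert v S" "w = (\<lambda>i. s i - u i)" by blast
      have "mon (\<lambda>i. u i + w i) \<in> ?I"
      proof (cases "s = v")
        case True
        then show ?thesis using s(2) disj
          by (intro mon_in_mon_ideal_divisible[of "\<lambda>i. u i + v i"]) fastforce+
      next
        case False
        then show ?thesis using s by (intro mon_in_mon_ideal_divisible[of s]) auto
      qed
      then show "mon u \<otimes> mon w \<in> ?I" by (simp add: mon_add)
    qed
    then show "r \<in> ?I" using eq g(1) SI by auto
  qed
qed

lemma mon_ideal_univariate:
  assumes "\<And>s. s \<in> S \<Longrightarrow> deg s > 0" "S \<noteq> {}"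
    and single_var: "\<And>s i j. \<lbrakk>s \<in> S; i \<in> D; j \<in> D; s i > 0; s j > 0\<rbrakk> \<Longrightarrow> i = j"
  shows "mon_ideal S \<in> pure_powers"
proof -
  define W where "W = {t \<in> D. \<exists>s\<in>S. s t > 0}"
  \<comment> \<open>Among the powers of \<open>x t\<close> in \<open>S\<close> the least one
    suffices. Positivity excludes the generators in which \<open>x t\<close> does not occur.\<close>
  define f where "f t = (LEAST n. n > 0 \<and> (\<exists>s\<in>S. s t = n))" for t
  have WD: "W \<subseteq> D" by (auto simp: W_def)
  have f: "f t > 0 \<and> (\<exists>s\<in>S. s t = f t)" if "t \<in> W" for t
  proof -
    have "\<exists>n. n > 0 \<and> (\<exists>s\<in>S. s t = n)" using that by (auto simp: W_def)
    then show ?thesis unfolding f_def by (rule LeastI_ex)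
  qed
  have f_le: "f t \<le> s t" if "s \<in> S" "s t > 0" for s t
    unfolding f_def using that by (intro Least_le) blast
  have var: "\<exists>t\<in>W. s t > 0" if s: "s \<in> S" for s
  proof -
    obtain t where "t \<in> D" "s t > 0" by (rule deg_posE[OF assms(1)[OF s]])
    then show ?thesis using s by (auto simp: W_def)
  qed
  have "mon_ideal S = mon_ideal ((\<lambda>t. single t (f t)) ` W)"
  proof (intro equalityI mon_ideal_subset)
    fix s assume s: "s \<in> S"
    then obtain t where "t \<in> W" "s t > 0" using var by blast
    moreover from this have "\<forall>i\<in>D. single t (f t) i \<le> s i"
      using f_le s by (auto simp: single_def)
    ultimately show "\<exists>u\<in>(\<lambda>t. single t (f t)) ` W. \<forall>i\<in>D. u i \<le> s i" by blast
  next
    fix u assume "u \<in> (\<lambda>t. single t (f t)) ` W"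
    then obtain t where t: "t \<in> W" "u = single t (f t)" by blast
    then obtain s where s: "s \<in> S" "s t = f t" using f by blast
    have "s i \<le> u i" if i: "i \<in> D" for i
    proof (cases "i = t")
      case True
      then show ?thesis using s t by (simp add: single_def)
    next
      case False
      have "s t > 0" "t \<in> D" using f[OF t(1)] s(2) t(1) WD by auto
      then have "s i = 0" using single_var[OF s(1) i] False by blast
      then show ?thesis by simp
    qed
    then show "\<exists>s\<in>S. \<forall>i\<in>D. s i \<le> u i" using s(1) by blast
  qed
  then have "mon_ideal S = pure_power W f" using pure_power_eq[OF WD] by simp
  moreover have "W \<noteq> {}" using var assms(2) by blast
  ultimately show ?thesis using WD f unfolding pure_powers_def by blast
qed

lemma mon_ideal_decomposition:
  assumes "finite S" "S \<noteq> {}" "\<And>s. s \<in> S \<Longrightarrow> deg s > 0"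
  shows "\<exists>\<Q>. finite \<Q> \<and> \<Q> \<subseteq> pure_powers \<and> mon_ideal S = carrier R \<inter> \<Inter>\<Q>"
  using assms
proof (induct "sum deg S" arbitrary: S rule: less_induct)
  case less
  note fin = less.prems(1) and deg = less.prems(3)
  show ?case
  proof (cases "\<forall>s\<in>S. \<forall>i\<in>D. \<forall>j\<in>D. s i > 0 \<longrightarrow> s j > 0 \<longrightarrow> i = j")
    case True
    have "mon_ideal S \<in> pure_powers"
      by (rule mon_ideal_univariate[OF deg less.prems(2)]) (use True in blast)+
    moreover have "mon_ideal S \<subseteq> carrier R"
      using ideal.Icarr[OF ideal_mon_ideal] by blast
    ultimately show ?thesis by (intro exI[of _ "{mon_ideal S}"]) auto
  next
    case False
    then obtain s i j where s: "s \<in> S" "i \<in> D" "j \<in> D" "s i > 0" "s j > 0" "i \<noteq> j" by blast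
    \<comment> \<open>The full power of \<open>x i\<close> is split off from the rest, which still
      contains \<open>x j\<close>; both factors are nonconstant and of smaller degree.\<close>
    define u where "u = single i (s i)"
    define v where "v = s(i := 0)"
    define S' where "S' = S - {s}"
    have S': "finite S'" "S = insert s S'" "s \<notin> S'" using fin s(1) by (auto simp: S'_def)
    have sum_S: "sum deg S = deg s + sum deg S'" using S' by simp
    have suv: "s = (\<lambda>i. u i + v i)" by (auto simp: u_def v_def single_def)
    have u: "deg u > 0" "deg u < deg s"
    proof -
      show "deg u > 0" using s by (simp add: u_def)
      show "deg u < deg s" using s by (intro deg_strict_mono[of _ _ j]) (auto simp: u_def single_def)
    qed
    have v: "deg v > 0" "deg v < deg s"
    proof -
      have "deg v \<noteq> 0" using deg_eq_0[of v] s by (auto simp: v_def)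
      then show "deg v > 0" by simp
      show "deg v < deg s" using s by (intro deg_strict_mono[of _ _ i]) (auto simp: v_def)
    qed
    have "\<exists>\<Q>. finite \<Q> \<and> \<Q> \<subseteq> pure_powers \<and> mon_ideal (insert w S') = carrier R \<inter> \<Inter>\<Q>"
      if w: "deg w > 0" "deg w < deg s" for w
    proof (rule less.hyps)
      show "sum deg (insert w S') < sum deg S"
        \<comment> \<open>If \<open>w\<close> already belongs to \<open>S'\<close>, inserting it
          adds nothing, and the drop is all of \<open>deg s\<close>.\<close>
        using w(2) sum_S S'(1) by (cases "w \<in> S'") (auto simp: insert_absorb)
      show "deg a > 0" if "a \<in> insert w S'" for a using that w(1) deg by (auto simp: S'_def)
    qed (use S' in auto)
    from this[OF u] this[OF v] obtain \<U> \<V> where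
      U: "finite \<U>" "\<U> \<subseteq> pure_powers" "mon_ideal (insert u S') = carrier R \<inter> \<Inter>\<U>" and
      V: "finite \<V>" "\<V> \<subseteq> pure_powers" "mon_ideal (insert v S') = carrier R \<inter> \<Inter>\<V>"
      by blast
    have "mon_ideal S = mon_ideal (insert u S') \<inter> mon_ideal (insert v S')"
      unfolding S'(2) by (subst suv, subst mon_ideal_insert_Int[OF S'(1)])
        (auto simp: u_def v_def single_def)
    then have "mon_ideal S = carrier R \<inter> \<Inter>(\<U> \<union> \<V>)" unfolding U(3) V(3) by auto
    then show ?thesis using U V by (intro exI[of _ "\<U> \<union> \<V>"]) auto
  qed
qed

end

section \<open>Pure power decompositions\<close>

text \<open>Enumerate \<open>W\<close> first and its complement in \<open>{1..d}\<close> afterwards;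
  this realises a set of variables as the first values of a permutation.\<close>

lemma exists_permutes_image:
  assumes "W \<subseteq> {1..d::nat}"
  obtains \<tau> where "\<tau> permutes {1..d}" "\<tau> ` {1..card W} = W"
proof -
  let ?s = "card W"
  have finW: "finite W" using assms finite_subset by blast
  have sd: "?s \<le> d" using card_mono[OF _ assms] by simp
  obtain h where h: "bij_betw h {1..?s} W" using ex_bij_betw_nat_finite_1[OF finW] by blast
  have "card {Suc ?s..d} = card ({1..d} - W)" using card_Diff_subset[OF finW assms] by simp
  then obtain g where g: "bij_betw g {Suc ?s..d} ({1..d} - W)"
    using finite_same_card_bij[of "{Suc ?s..d}" "{1..d} - W"] by auto
  define \<tau> where "\<tau> j = (if j \<in> {1..?s} then h j else if j \<in> {Suc ?s..d} then g j else j)" for j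
  have 1: "bij_betw \<tau> {1..?s} W" using h by (rule bij_betw_cong[THEN iffD1, rotated]) (auto simp: \<tau>_def)
  have 2: "bij_betw \<tau> {Suc ?s..d} ({1..d} - W)"
    using g by (rule bij_betw_cong[THEN iffD1, rotated]) (auto simp: \<tau>_def)
  have "bij_betw \<tau> ({1..?s} \<union> {Suc ?s..d}) (W \<union> ({1..d} - W))"
    by (rule bij_betw_combine[OF 1 2]) auto
  moreover have eq: "{1..?s} \<union> {Suc ?s..d} = {1..d}" "W \<union> ({1..d} - W) = {1..d}"
    using sd assms by auto
  ultimately have "bij_betw \<tau> {1..d} {1..d}" by (simp only: eq)
  moreover have "\<tau> j = j" if j: "j \<notin> {1..d}" for j
  proof -
    have "j \<notin> {1..?s}" "j \<notin> {Suc ?s..d}" using j eq(1) by blast+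
    then show ?thesis by (simp only: \<tau>_def if_False)
  qed
  ultimately have "\<tau> permutes {1..d}" by (rule bij_imp_permutes)
  moreover have "\<tau> ` {1..?s} = W" using 1 by (simp add: bij_betw_def)
  ultimately show ?thesis using that by blast
qed

lemma pure_power_ideal_iff:
  assumes "prime_variables R {1..d} x"
  shows "pure_power_ideal R d x Q \<longleftrightarrow> Q \<in> prime_variables.pure_powers R {1..d} x"
proof -
  interpret prime_variables R "{1..d}" x by fact
  show ?thesis
  proof
    assume "pure_power_ideal R d x Q"
    then obtain \<tau> s and e :: "nat \<Rightarrow> nat" where *: "\<tau> permutes {1..d}" "1 \<le> s" "s \<le> d"
      "\<And>j. j \<in> {1..s} \<Longrightarrow> e j > 0" and Q: "Q = Idl\<^bsub>R\<^esub> ((\<lambda>j. x (\<tau> j) [^]\<^bsub>R\<^esub> e j) ` {1..s})"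
      unfolding pure_power_ideal_def by blast
    \<comment> \<open>Exponents indexed by positions become exponents indexed by variables through
      the inverse permutation.\<close>
    let ?W = "\<tau> ` {1..s}" and ?f = "\<lambda>t. e (inv_into UNIV \<tau> t)"
    have inv: "inv_into UNIV \<tau> (\<tau> j) = j" for j using permutes_inverses(2)[OF *(1)] .
    have "Q = pure_power ?W ?f" unfolding Q pure_power_def image_image inv ..
    moreover have "?W \<subseteq> {1..d}" using *(3) permutes_image[OF *(1)] by auto
    moreover have "?W \<noteq> {}" using *(2) by simp
    moreover have "\<forall>t\<in>?W. ?f t > 0" using *(4) inv by auto
    ultimately show "Q \<in> pure_powers" unfolding pure_powers_def by blast
  next
    assume "Q \<in> pure_powers"
    then obtain W f where W: "W \<subseteq> {1..d}" "W \<noteq> {}" "\<forall>t\<in>W. f t > 0" "Q = pure_power W f"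
      by (rule pure_powersE)
    obtain \<tau> where \<tau>: "\<tau> permutes {1..d}" "\<tau> ` {1..card W} = W" by (rule exists_permutes_image[OF W(1)])
    have "finite W" using W(1) finite_subset by blast
    then have "1 \<le> card W" using W(2) by (simp add: Suc_leI card_gt_0_iff)
    moreover have "card W \<le> d" using card_mono[OF _ W(1)] by simp
    moreover have "\<forall>j\<in>{1..card W}. f (\<tau> j) > 0" using W(3) \<tau>(2) by blast
    moreover have "Q = Idl\<^bsub>R\<^esub> ((\<lambda>j. x (\<tau> j) [^]\<^bsub>R\<^esub> f (\<tau> j)) ` {1..card W})"
      unfolding W(4) pure_power_def by (subst (1) \<tau>(2)[symmetric]) (simp only: image_image)
    ultimately show "pure_power_ideal R d x Q"
      unfolding pure_power_ideal_def
      using \<tau>(1) by (intro exI[of _ \<tau>] exI[of _ "card W"] exI[of _ "\<lambda>j. f (\<tau> j)"]) blast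
  qed
qed

text \<open>Each Q contains some Q' of the other family, which in turn contains some Q'' of the
  first; irredundancy forces Q'' and Q to occupy the same position, so Q = Q'.\<close>

lemma pure_power_decomposition_subset:
  assumes pv: "prime_variables R {1..d} x"
    and Qs: "pure_power_decomposition R d x I Qs" and Qs': "pure_power_decomposition R d x I Qs'"
  shows "set Qs \<subseteq> set Qs'"
proof
  interpret prime_variables R "{1..d}" x by fact
  have pure: "set Qs \<subseteq> pure_powers" "set Qs' \<subseteq> pure_powers"
    and I: "I = carrier R \<inter> \<Inter>(set Qs)" "I = carrier R \<inter> \<Inter>(set Qs')"
    and irr: "irredundant_intersection R Qs"
    using Qs Qs' pure_power_ideal_iff[OF pv] unfolding pure_power_decomposition_def by auto
  fix Q assume Q: "Q \<in> set Qs"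
  then obtain k where k: "k < length Qs" "Q = Qs ! k" by (metis in_set_conv_nth)
  have "carrier R \<inter> \<Inter>(set Qs') \<subseteq> Q" using I Q by blast
  then obtain Q' where Q': "Q' \<in> set Qs'" "Q' \<subseteq> Q"
    using pure_powers_Inter_le[of "set Qs'" Q] pure Q by blast
  have "carrier R \<inter> \<Inter>(set Qs) \<subseteq> Q'" using I Q' by blast
  then obtain Q'' where Q'': "Q'' \<in> set Qs" "Q'' \<subseteq> Q'"
    using pure_powers_Inter_le[of "set Qs" Q'] pure Q' by blast
  then obtain l where l: "l < length Qs" "Q'' = Qs ! l" by (metis in_set_conv_nth)
  have "l = k"
  proof (rule ccontr)
    assume "l \<noteq> k"
    then have "(\<Inter>j\<in>{..<length Qs} - {k}. Qs ! j) \<subseteq> Qs ! l" using l(1) by blast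
    then have "carrier R \<inter> (\<Inter>j\<in>{..<length Qs} - {k}. Qs ! j) \<subseteq> Qs ! k"
      using Q'(2) Q''(2) k(2) l(2) by blast
    then show False using irr k(1) unfolding irredundant_intersection_def by blast
  qed
  then have "Q = Q'" using Q'(2) Q''(2) k(2) l(2) by blast
  then show "Q \<in> set Qs'" using Q'(1) by simp
qed

section \<open>From the regular sequence to the theorem\<close>

lemma prime_variables_regular_sequence:
  fixes x :: "nat \<Rightarrow> 'a"
  assumes "cring R" and "noetherian_ring R" and reg: "regular_sequence R d x"
    and xJ: "x ` {1..d} \<subseteq> jacobson_radical R" and P: "primeideal (Idl\<^bsub>R\<^esub> (x ` {1..d})) R"
  shows "prime_variables R {1..d} x"
proof -
  interpret noetherian_cring R using assms(1,2) by (rule noetherian_cring.intro)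
  have xR: "x ` {1..d} \<subseteq> carrier R" using reg unfolding regular_sequence_def by blast
  have reg': "regular_mod R (Idl\<^bsub>R\<^esub> (x ` {1..<i})) (x i)" if i: "i \<in> {1..d}" for i
  proof -
    have "x ` {1..<i} \<subseteq> carrier R" using xR i by auto
    then interpret J: ideal "Idl\<^bsub>R\<^esub> (x ` {1..<i})" R by (rule genideal_ideal)
    have "x i \<in> carrier R" using xR i by blast
    then show ?thesis
      using reg i unfolding regular_sequence_def Let_def
      by (intro J.regular_mod_if_quotient_regular is_cring) blast+
  qed
  have prime: "primeideal (Idl\<^bsub>R\<^esub> (x ` T)) R" if "T \<subseteq> {1..d}" for T
    using regular_sequence_subset_primeideal[OF xJ reg' P that] by blast
  show ?thesis
  proof (intro prime_variables.intro prime_variables_axioms.intro is_cring)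
    fix T t assume T: "T \<subseteq> {1..d}" and t: "t \<in> {1..d}" "t \<notin> T"
    interpret Q: primeideal "Idl\<^bsub>R\<^esub> (x ` T)" R by (rule prime[OF T])
    \<comment> \<open>Were \<open>x t\<close> in this proper ideal, regularity applied to
      \<open>x t\<close> times 1 would put 1 into it.\<close>
    have "regular_mod R (Idl\<^bsub>R\<^esub> (x ` T)) (x t)"
      using regular_sequence_permutable[OF xJ reg' order_refl T, of t] t by blast
    moreover have "x t \<in> carrier R" using xR t by blast
    moreover have "\<one>\<^bsub>R\<^esub> \<notin> Idl\<^bsub>R\<^esub> (x ` T)" using Q.one_imp_carrier Q.I_notcarr by blast
    ultimately show "x t \<notin> Idl\<^bsub>R\<^esub> (x ` T)" using regular_modD[of R _ "x t" "\<one>\<^bsub>R\<^esub>"] by auto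
  qed (use xR prime in auto)
qed

theorem theorem1p1:
  fixes R :: "('a, 'b) ring_scheme" and d :: nat and x :: "nat \<Rightarrow> 'a" and I :: "'a set"
  assumes "cring R" and "noetherian_ring R"
    and "regular_sequence R d x"
    and "x ` {1..d} \<subseteq> jacobson_radical R"
    and "primeideal (Idl\<^bsub>R\<^esub> (x ` {1..d})) R"
    and "monomial_ideal R d x I" and "I \<noteq> {\<zero>\<^bsub>R\<^esub>}"
  shows "(\<exists>Qs. pure_power_decomposition R d x I Qs) \<and>
    (\<forall>Qs Qs'. pure_power_decomposition R d x I Qs \<longrightarrow>
       pure_power_decomposition R d x I Qs' \<longrightarrow> set Qs = set Qs')"
proof
  have pv: "prime_variables R {1..d} x" using assms(1-5) by (rule prime_variables_regular_sequence)
  interpret prime_variables R "{1..d}" x by (rule pv)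
  interpret noetherian_cring R using assms(1,2) by (rule noetherian_cring.intro)
  show "\<forall>Qs Qs'. pure_power_decomposition R d x I Qs \<longrightarrow>
       pure_power_decomposition R d x I Qs' \<longrightarrow> set Qs = set Qs'"
    using pure_power_decomposition_subset[OF pv] by blast
  obtain S where S: "S \<subseteq> monomials R d x" "I = Idl\<^bsub>R\<^esub> S" and ne: "I \<noteq> carrier R"
    using assms(6) unfolding monomial_ideal_def by blast
  have "mon = (\<lambda>e. \<Otimes>\<^bsub>R\<^esub>i\<in>{1..d}. x i [^]\<^bsub>R\<^esub> e i)" by (rule ext) (rule mon_def)
  then have "monomials R d x = range mon" unfolding monomials_def by auto
  then have S_mon: "S \<subseteq> range mon" using S(1) by simp
  then have "S \<subseteq> carrier R" using mon_closed by blast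
  then obtain F where F: "F \<subseteq> S" "finite F" "Idl\<^bsub>R\<^esub> F = Idl\<^bsub>R\<^esub> S"
    by (rule genideal_finite_subset)
  obtain E where E: "finite E" "F = mon ` E"
    using finite_subset_image[OF F(2)] F(1) S_mon by blast
  have I: "I = mon_ideal E" using S(2) F(3) E(2) mon_ideal_def by simp
  \<comment> \<open>Here \<open>I\<close> being non-zero enters: without generators the ideal would
    be zero, and the decomposition lemma needs at least one.\<close>
  have "Idl\<^bsub>R\<^esub> {} \<subseteq> {\<zero>\<^bsub>R\<^esub>}" using genideal_minimal[OF zeroideal] by simp
  moreover have "\<zero>\<^bsub>R\<^esub> \<in> I"
    unfolding I using additive_subgroup.zero_closed[OF ideal.axioms(1)[OF ideal_mon_ideal]] .
  ultimately have "Idl\<^bsub>R\<^esub> {} \<noteq> I" using assms(7) by blast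
  then have "E \<noteq> {}" by (metis S(2) F(3) E(2) image_empty)
  \<comment> \<open>A generator of degree 0 is 1, which properness of \<open>I\<close>
    excludes.\<close>
  moreover have "deg s > 0" if "s \<in> E" for s
  proof (rule ccontr)
    assume "\<not> deg s > 0"
    then have "mon s = \<one>\<^bsub>R\<^esub>" using mon_eq_one[of s] deg_eq_0[of s] by blast
    then have "\<one>\<^bsub>R\<^esub> \<in> I" using mon_in_mon_ideal[OF that] I by simp
    then show False using ne ideal.one_imp_carrier[OF ideal_mon_ideal, of E] I by simp
  qed
  ultimately obtain \<Q> where \<Q>: "finite \<Q>" "\<Q> \<subseteq> pure_powers" "I = carrier R \<inter> \<Inter>\<Q>"
    using mon_ideal_decomposition[OF E(1)] I by blast
  obtain Qs where Qs: "set Qs \<subseteq> \<Q>" "carrier R \<inter> \<Inter>(set Qs) = carrier R \<inter> \<Inter>\<Q>"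
    "irredundant_intersection R Qs"
    by (rule irredundant_subfamily[OF \<Q>(1)])
  have "primaryideal Q R \<and> pure_power_ideal R d x Q" if "Q \<in> set Qs" for Q
  proof -
    have Q: "Q \<in> pure_powers" using that Qs(1) \<Q>(2) by blast
    then obtain W f where "W \<subseteq> {1..d}" "\<forall>t\<in>W. f t > 0" "Q = pure_power W f"
      by (rule pure_powersE) blast
    then have "primaryideal Q R" using primaryideal_pure_power[of W f] by simp
    then show ?thesis using Q pure_power_ideal_iff[OF pv] by simp
  qed
  then show "\<exists>Qs. pure_power_decomposition R d x I Qs"
    unfolding pure_power_decomposition_def using Qs(2,3) \<Q>(3) by (intro exI[of _ Qs]) simp
qed

end
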